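(* Let $\Gamma:[0,1]\to\mathbb{R}^2$ be a strictly concave curve contained in its support triangle, with $A=\Gamma(0)$, $B=\Gamma(1)$, and $C$ the intersection of the tangents to $\Gamma$ at $A$ and $B$. Fix a choice of normals $(\alpha,\beta)$, $(\alpha',\beta')$ of the tangents at $A$, $B$ as in the context, and let $\gamma_{a,b}$, $F_\Gamma(s)$ and the $SL(2,\mathbb{Z})$-lengths be defined with respect to this choice. Then $$F_\Gamma(1)=\sum_{\substack{a,b,c,d\in\mathbb{Z}_{\ge 0}\\ ad-bc=1}}|\gamma_{a,b}+\gamma_{c,d}-\gamma_{a+c,b+d}|$$ equals the sum of the $SL(2,\mathbb{Z})$-lengths of the two straight sides of the $\Gamma$-triangle, i.e. $\frac{|AC|}{\sqrt{\alpha^2+\beta^2}}+\frac{|BC|}{\sqrt{\alpha'^2+\beta'^2}}$, while $$F_\Gamma(2)=\sum_{\substack{a,b,c,d\in\mathbb{Z}_{\ge 0}\\ ad-bc=1}}(\gamma_{a,b}+\gamma_{c,d}-\gamma_{a+c,b+d})^2$$ equals twice the area of the $\Gamma$-triangle.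
   Context: A strictly concave curve $\Gamma:[0,1]\to\mathbb{R}^2$ means an injective continuous curve that has a tangent line at every point (one-sided at the endpoints), whose image contains no straight segment, and whose image together with the chord $\Gamma(0)\Gamma(1)$ bounds a convex region. Put $A=\Gamma(0)$, $B=\Gamma(1)$; the tangents to $\Gamma$ at $A$ and at $B$ are assumed to meet in one point $C$. The (full) triangle $ABC$ is the support triangle of $\Gamma$ if it contains the image of $\Gamma$. The $\Gamma$-triangle is the curvilinear triangle (region) bounded by the straight segments $AC$, $BC$ and by the curve $\Gamma$. Choice of normals: choose equations $\alpha x+\beta y-\gamma_{1,0}=0$ and $\alpha' x+\beta' y-\gamma_{0,1}=0$ of the tangents at $A$ and at $B$ respectively, with real coefficients, such that $\det\begin{pmatrix}\alpha&\beta\\ \alpha'&\beta'\end{pmatrix}=1$ and $\Gamma$ lies in the intersection of the half-planes $\alpha x+\beta y-\gamma_{1,0}\le 0$ and $\alpha' x+\beta' y-\gamma_{0,1}\le 0$ ($\Gamma$ is assumed to be traversed in the direction for which such a choice exists). For coprime non-negative integers $a,b$, let $\gamma_{a,b}$ be the real number such that the line $(a\alpha+b\alpha')x+(a\beta+b\beta')y-\gamma_{a,b}=0$ is tangent to $\Gamma$, with $\Gamma$ contained in the half-plane where the left-hand side is $\le 0$. For $a,b,c,d\in\mathbb{Z}_{\ge0}$ with $ad-bc=1$, let $S_{a,b,c,d}$ be the area of the triangle $$(a\alpha+b\alpha')x+(a\beta+b\beta')y\le\gamma_{a,b},\quad (c\alpha+d\alpha')x+(c\beta+d\beta')y\le\gamma_{c,d},\quad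 ((a+c)\alpha+(b+d)\alpha')x+((a+c)\beta+(b+d)\beta')y\ge\gamma_{a+c,b+d},$$ and put $f_\Gamma(a,b,c,d)=\sqrt{2S_{a,b,c,d}}$ and $F_\Gamma(s)=\sum f_\Gamma(a,b,c,d)^s$, the sum being over all $a,b,c,d\in\mathbb{Z}_{\ge 0}$ with $ad-bc=1$. The $SL(2,\mathbb{Z})$-length of the side $AC$ is its Euclidean length divided by $\sqrt{\alpha^2+\beta^2}$, and that of the side $BC$ is its Euclidean length divided by $\sqrt{\alpha'^2+\beta'^2}$. *)

theory Defs
  imports "HOL-Analysis.Analysis"
begin

text \<open>
  A line \<open>L\<close> through \<open>\<Gamma> t\<close> is tangent there if the angle between \<open>L\<close> and the secant from
  \<open>\<Gamma> t\<close> to \<open>\<Gamma> s\<close> tends to \<open>0\<close> as \<open>s\<close> tends to \<open>t\<close>; the quotient below is the sine of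
  this angle. The limit is taken within \<open>{0..1}\<close>, so it is one-sided at the end points.
\<close>

definition tangent_line_at :: "(real \<Rightarrow> real^2) \<Rightarrow> real \<Rightarrow> (real^2) set \<Rightarrow> bool" where
  "tangent_line_at \<Gamma> t L \<longleftrightarrow>
     affine L \<and> aff_dim L = 1 \<and> \<Gamma> t \<in> L \<and>
     ((\<lambda>s. infdist (\<Gamma> s) L / dist (\<Gamma> s) (\<Gamma> t)) \<longlongrightarrow> 0) (at t within {0..1})"

definition strictly_concave_curve :: "(real \<Rightarrow> real^2) \<Rightarrow> bool" where
  "strictly_concave_curve \<Gamma> \<longleftrightarrow>
     arc \<Gamma> \<and>
     (\<forall>t\<in>{0..1}. \<exists>L. tangent_line_at \<Gamma> t L) \<and>
     (\<forall>x y. x \<noteq> y \<longrightarrow> \<not> closed_segment x y \<subseteq> path_image \<Gamma>) \<and>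
     (\<exists>K. open K \<and> convex K \<and> bounded K \<and> K \<noteq> {} \<and>
          frontier K = path_image \<Gamma> \<union> closed_segment (\<Gamma> 0) (\<Gamma> 1))"

definition eq_line :: "real \<Rightarrow> real \<Rightarrow> real \<Rightarrow> (real^2) set" where
  "eq_line p q g = {v. p * v$1 + q * v$2 - g = 0}"

definition half_plane_le :: "real \<Rightarrow> real \<Rightarrow> real \<Rightarrow> (real^2) set" where
  "half_plane_le p q g = {v. p * v$1 + q * v$2 - g \<le> 0}"

definition half_plane_ge :: "real \<Rightarrow> real \<Rightarrow> real \<Rightarrow> (real^2) set" where
  "half_plane_ge p q g = {v. p * v$1 + q * v$2 - g \<ge> 0}"

definition choice_of_normals ::
    "(real \<Rightarrow> real^2) \<Rightarrow> real \<Rightarrow> real \<Rightarrow> real \<Rightarrow> real \<Rightarrow> bool" where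
  "choice_of_normals \<Gamma> \<alpha> \<beta> \<alpha>' \<beta>' \<longleftrightarrow>
     \<alpha> * \<beta>' - \<beta> * \<alpha>' = 1 \<and>
     (\<exists>g g'. tangent_line_at \<Gamma> 0 (eq_line \<alpha> \<beta> g) \<and> tangent_line_at \<Gamma> 1 (eq_line \<alpha>' \<beta>' g') \<and>
             path_image \<Gamma> \<subseteq> half_plane_le \<alpha> \<beta> g \<inter> half_plane_le \<alpha>' \<beta>' g')"

text \<open>The number \<open>\<gamma>\<^bsub>a,b\<^esub>\<close>; it is only meaningful for coprime \<open>a\<close>, \<open>b\<close>.\<close>

definition tangent_const ::
    "(real \<Rightarrow> real^2) \<Rightarrow> real \<Rightarrow> real \<Rightarrow> real \<Rightarrow> real \<Rightarrow> nat \<Rightarrow> nat \<Rightarrow> real" where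
  "tangent_const \<Gamma> \<alpha> \<beta> \<alpha>' \<beta>' a b =
     (THE g. (\<exists>t\<in>{0..1}. tangent_line_at \<Gamma> t
                 (eq_line (real a * \<alpha> + real b * \<alpha>') (real a * \<beta> + real b * \<beta>') g)) \<and>
             path_image \<Gamma> \<subseteq>
                 half_plane_le (real a * \<alpha> + real b * \<alpha>') (real a * \<beta> + real b * \<beta>') g)"

definition cut_triangle ::
    "(real \<Rightarrow> real^2) \<Rightarrow> real \<Rightarrow> real \<Rightarrow> real \<Rightarrow> real \<Rightarrow> nat \<Rightarrow> nat \<Rightarrow> nat \<Rightarrow> nat \<Rightarrow> (real^2) set" where
  "cut_triangle \<Gamma> \<alpha> \<beta> \<alpha>' \<beta>' a b c d =
     half_plane_le (real a * \<alpha> + real b * \<alpha>') (real a * \<beta> + real b * \<beta>')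
        (tangent_const \<Gamma> \<alpha> \<beta> \<alpha>' \<beta>' a b) \<inter>
     half_plane_le (real c * \<alpha> + real d * \<alpha>') (real c * \<beta> + real d * \<beta>')
        (tangent_const \<Gamma> \<alpha> \<beta> \<alpha>' \<beta>' c d) \<inter>
     half_plane_ge (real (a + c) * \<alpha> + real (b + d) * \<alpha>') (real (a + c) * \<beta> + real (b + d) * \<beta>')
        (tangent_const \<Gamma> \<alpha> \<beta> \<alpha>' \<beta>' (a + c) (b + d))"

definition f_Gamma ::
    "(real \<Rightarrow> real^2) \<Rightarrow> real \<Rightarrow> real \<Rightarrow> real \<Rightarrow> real \<Rightarrow> nat \<Rightarrow> nat \<Rightarrow> nat \<Rightarrow> nat \<Rightarrow> real" where
  "f_Gamma \<Gamma> \<alpha> \<beta> \<alpha>' \<beta>' a b c d =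
     sqrt (2 * measure lebesgue (cut_triangle \<Gamma> \<alpha> \<beta> \<alpha>' \<beta>' a b c d))"

definition SL2_nonneg :: "(nat \<times> nat \<times> nat \<times> nat) set" where
  "SL2_nonneg = {(a, b, c, d). int a * int d - int b * int c = 1}"

definition F_Gamma ::
    "(real \<Rightarrow> real^2) \<Rightarrow> real \<Rightarrow> real \<Rightarrow> real \<Rightarrow> real \<Rightarrow> real \<Rightarrow> real" where
  "F_Gamma \<Gamma> \<alpha> \<beta> \<alpha>' \<beta>' s =
     (\<Sum>\<^sub>\<infinity>(a, b, c, d)\<in>SL2_nonneg. f_Gamma \<Gamma> \<alpha> \<beta> \<alpha>' \<beta>' a b c d powr s)"

definition Gamma_triangle :: "(real \<Rightarrow> real^2) \<Rightarrow> real^2 \<Rightarrow> (real^2) set" where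
  "Gamma_triangle \<Gamma> C =
     inside (closed_segment (\<Gamma> 0) C \<union> closed_segment (\<Gamma> 1) C \<union> path_image \<Gamma>)"

text \<open>The \<open>SL(2,\<int>)\<close>-length of a segment \<open>PQ\<close> on a line with chosen normal \<open>(p, q)\<close>.\<close>

definition SL2_length :: "real \<Rightarrow> real \<Rightarrow> real^2 \<Rightarrow> real^2 \<Rightarrow> real" where
  "SL2_length p q P Q = dist P Q / sqrt (p\<^sup>2 + q\<^sup>2)"

end

theory Submission
  imports Defs
begin

text \<open>
  In the coordinates \<open>X = g - \<alpha> x - \<beta> y\<close>, \<open>Y = g' - \<alpha>' x - \<beta>' y\<close> the support triangle has vertices
  \<open>C = (0, 0)\<close>, \<open>A = (0, p)\<close>, \<open>B = (q, 0)\<close>, where \<open>p\<close>, \<open>q\<close> are the lengths of \<open>AC\<close>, \<open>BC\<close>. With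
  \<open>h(v) = min v \<cdot> z\<close> over \<open>z \<in> \<Gamma>\<close>, the number \<open>\<gamma>\<close> is a linear function minus \<open>h\<close>, so every summand is
  the defect of superadditivity \<open>f(v, w) = h(v + w) - h(v) - h(w) \<ge> 0\<close>, and the triangle cut off at
  \<open>(v, w)\<close> has area \<open>f(v, w)\<^sup>2 / 2\<close>.

  The tangent segment with normal \<open>u = v + w\<close> is created with length \<open>f(v, w)\<close> and is exhausted by
  the later cuts: \<open>f(v, w) = (\<Sum>k. f(v + k u, u)) + (\<Sum>k. f(u, w + k u))\<close>. Both sums telescope, and
  their limits are read off from the unique point of \<open>\<Gamma>\<close> on the tangent. The same sums for the two
  sides of the support triangle are \<open>p\<close> and \<open>q\<close>. Adding everything up gives \<open>2 F(1) = p + q + F(1)\<close>.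

  For the area, a point \<open>z\<close> off countably many lines determines the superadditive function
  \<open>\<phi>(v) = h(v) - v \<cdot> z\<close>. The cut triangles containing \<open>z\<close> belong to the pairs \<open>v, w\<close> with
  \<open>\<phi>(v), \<phi>(w) \<le> 0 < \<phi>(v + w)\<close>. There is at most one such pair, and descending the Stern-Brocot tree
  towards a vector with \<open>\<phi> > 0\<close> finds one precisely when \<open>z\<close> is between \<open>\<Gamma>\<close> and \<open>C\<close>.
\<close>

subsection \<open>Sums over nonnegative matrices of determinant one\<close>

lemma SL2_nonneg_iff: "(a, b, c, d) \<in> SL2_nonneg \<longleftrightarrow> a * d = b * c + 1"
proof -
  have "int a * int d - int b * int c = 1 \<longleftrightarrow> int (a * d) = int (b * c + 1)"
    by auto
  then show ?thesis
    unfolding SL2_nonneg_def using of_nat_eq_iff[of "a * d" "b * c + 1", where 'a = int] by simp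
qed

lemma SL2_nonneg_pos:
  assumes "(a, b, c, d) \<in> SL2_nonneg"
  shows "0 < a" "0 < d"
  using assms by (auto simp: SL2_nonneg_iff intro: gr0I)

text \<open>For rows \<open>v\<close>, \<open>w\<close> with sum \<open>u\<close> the value has rows
  \<open>v + k u\<close> and \<open>u\<close>. As \<open>k\<close> grows, these are the successive
  cuts along the tangent with normal \<open>u\<close>, on the side of \<open>v\<close>.\<close>

definition branch_right :: "(nat \<times> nat \<times> nat \<times> nat) \<times> nat \<Rightarrow> nat \<times> nat \<times> nat \<times> nat" where
  "branch_right = (\<lambda>((a, b, c, d), k). (a + k * (a + c), b + k * (b + d), a + c, b + d))"

text \<open>Exchanging both rows and columns keeps the determinant. Conjugating
  \<open>branch_right\<close> with it gives the other branch, with rows \<open>u\<close> and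
  \<open>w + k u\<close>.\<close>

definition antitranspose :: "nat \<times> nat \<times> nat \<times> nat \<Rightarrow> nat \<times> nat \<times> nat \<times> nat" where
  "antitranspose = (\<lambda>(a, b, c, d). (d, c, b, a))"

lemma bij_betw_antitranspose: "bij_betw antitranspose SL2_nonneg SL2_nonneg"
  by (rule bij_betwI[where g = antitranspose]) (auto simp: antitranspose_def SL2_nonneg_iff mult.commute)

lemma branch_rightE:
  assumes "M \<in> branch_right ` (SL2_nonneg \<times> UNIV)"
  obtains a b c d k where "(a, b, c, d) \<in> SL2_nonneg"
    "M = (a + k * (a + c), b + k * (b + d), a + c, b + d)"
proof -
  obtain x k where "x \<in> SL2_nonneg" "M = branch_right (x, k)" using assms by auto
  then show ?thesis using that[of _ _ _ _ k] by (cases x) (auto simp: branch_right_def)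
qed

text \<open>Going back means subtracting the second row \<open>k\<close> times from the first. The
  second column forces \<open>k\<close> to be the quotient of \<open>b\<close> by \<open>d\<close>,
  and the determinant makes this quotient fit the first column. This fails only for
  \<open>c = 0\<close>, where the rows are \<open>(1, k)\<close> and \<open>(0, 1)\<close>.\<close>

lemma bij_betw_branch_right:
  "bij_betw branch_right (SL2_nonneg \<times> UNIV) (SL2_nonneg - range (\<lambda>k. (1, k, 0, 1)))"
proof (rule bij_betw_imageI)
  show "inj_on branch_right (SL2_nonneg \<times> UNIV)"
  proof (rule inj_onI, clarify)
    fix a b c d k a' b' c' d' k'
    assume M: "(a, b, c, d) \<in> SL2_nonneg" and M': "(a', b', c', d') \<in> SL2_nonneg"
      and eq: "branch_right ((a, b, c, d), k) = branch_right ((a', b', c', d'), k')"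
    have e: "a + k * (a + c) = a' + k' * (a' + c')" "b + k * (b + d) = b' + k' * (b' + d')"
        "a + c = a' + c'" "b + d = b' + d'"
      using eq by (auto simp: branch_right_def)
    have "d > 0" "d' > 0" using M M' SL2_nonneg_pos by blast+
    then have "(b + k * (b + d)) div (b + d) = k" "(b' + k' * (b' + d')) div (b' + d') = k'"
      by simp_all
    then have "k = k'" using e by metis
    then show "((a, b, c, d) = (a', b', c', d')) \<and> k = k'" using e by auto
  qed
  show "branch_right ` (SL2_nonneg \<times> UNIV) = SL2_nonneg - range (\<lambda>k. (1, k, 0, 1))"
  proof (intro equalityI subsetI)
    fix M assume "M \<in> branch_right ` (SL2_nonneg \<times> UNIV)"
    then obtain a b c d k where M: "(a, b, c, d) \<in> SL2_nonneg"
        "M = (a + k * (a + c), b + k * (b + d), a + c, b + d)"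
      by (rule branch_rightE)
    then show "M \<in> SL2_nonneg - range (\<lambda>k. (1, k, 0, 1))"
      using SL2_nonneg_pos[OF M(1)] by (auto simp: SL2_nonneg_iff algebra_simps)
  next
    fix M assume M: "M \<in> SL2_nonneg - range (\<lambda>k. (1, k, 0, 1))"
    obtain a b c d where Md: "M = (a, b, c, d)" by (cases M) auto
    have det: "a * d = b * c + 1" using M Md by (auto simp: SL2_nonneg_iff)
    have c: "c > 0"
    proof (rule gr0I)
      assume "c = 0"
      with det have "M = (1, b, 0, 1)" using Md by auto
      with M show False by auto
    qed
    have d: "d > 0" using det by (auto intro: gr0I)
    define k where "k = b div d"
    define b0 where "b0 = b mod d"
    have b: "b = b0 + k * d" and b0: "b0 < d" using d by (auto simp: k_def b0_def)
    have ad: "a * d = b0 * c + 1 + (k * c) * d" using det b by (simp add: algebra_simps)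
    then have "(k * c) * d \<le> a * d" by simp
    then have kc: "k * c \<le> a" using d by simp
    define a0 where "a0 = a - k * c"
    have a: "a = a0 + k * c" using kc by (simp add: a0_def)
    have det0: "a0 * d = b0 * c + 1" using ad a by (simp add: algebra_simps)
    have "b0 * c + 1 \<le> (b0 + 1) * c" using c by (simp add: algebra_simps)
    also have "\<dots> \<le> d * c" using b0 by (intro mult_right_mono) auto
    finally have "a0 * d \<le> c * d" using det0 by (simp add: mult.commute)
    then have a0: "a0 \<le> c" using d by simp
    have "a0 * b0 \<le> b0 * c" using mult_le_mono2[OF a0, of b0] by (simp only: mult.commute)
    then have "a0 * (d - b0) = b0 * (c - a0) + 1"
      using det0 by (simp only: diff_mult_distrib2 mult.commute[of b0 a0])
    then have "(a0, b0, c - a0, d - b0) \<in> SL2_nonneg" by (simp add: SL2_nonneg_iff)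
    moreover have "M = branch_right ((a0, b0, c - a0, d - b0), k)"
      using Md a b a0 b0 by (simp add: branch_right_def)
    ultimately show "M \<in> branch_right ` (SL2_nonneg \<times> UNIV)" by blast
  qed
qed

lemma finite_SL2_bounded: "finite {M \<in> SL2_nonneg. (case M of (a, b, c, d) \<Rightarrow> a + b + c + d) \<le> n}"
  by (rule finite_subset[of _ "{..n} \<times> {..n} \<times> {..n} \<times> {..n}"]) auto

text \<open>Grouping the matrices by their origin under \<open>branch_right\<close> splits the sum
  of \<open>f\<close> into \<open>q\<close> and the sum of \<open>r\<close>. The truncated
  inequality comes first because it needs no summability.\<close>

lemma branch_right_sum:
  fixes f r :: "nat \<times> nat \<times> nat \<times> nat \<Rightarrow> real"
  assumes nonneg: "\<And>M. M \<in> SL2_nonneg \<Longrightarrow> 0 \<le> f M"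
    and r: "\<And>M. M \<in> SL2_nonneg \<Longrightarrow> (\<lambda>k. f (branch_right (M, k))) sums r M"
    and q: "(\<lambda>k. f (1, k, 0, 1)) sums q"
  defines "S \<equiv> \<lambda>n. {M \<in> SL2_nonneg. (case M of (a, b, c, d) \<Rightarrow> a + b + c + d) \<le> n}"
  shows branch_right_sum_le: "sum f (S n) \<le> q + sum r (S n)"
    and branch_right_has_sum: "(f has_sum s) SL2_nonneg \<Longrightarrow> (r has_sum (s - q)) SL2_nonneg"
proof -
  let ?e = "\<lambda>k::nat. (1::nat, k, 0::nat, 1::nat)"
  have e: "?e k \<in> SL2_nonneg" for k by (simp add: SL2_nonneg_iff)
  have inj_e: "inj ?e" by (auto simp: inj_on_def)
  have bR: "branch_right x \<in> SL2_nonneg" if "x \<in> SL2_nonneg \<times> UNIV" for x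
    using bij_betw_branch_right that by (auto simp: bij_betw_def)
  have hq: "((\<lambda>k. f (?e k)) has_sum q) UNIV"
    using q nonneg[OF e] by (intro sums_nonneg_imp_has_sum)
  have hr: "((\<lambda>k. f (branch_right (M, k))) has_sum r M) UNIV" if "M \<in> SL2_nonneg" for M
    using r[OF that] nonneg[OF bR] that by (intro sums_nonneg_imp_has_sum) auto
  have fin: "finite (S n)" unfolding S_def by (rule finite_SL2_bounded)
  \<comment> \<open>Both \<open>k\<close> and the entry sum of the preimage are at most the entry
    sum of the image, so truncation by \<open>n\<close> passes to both factors.\<close>
  have sub: "S n \<subseteq> ?e ` {..n} \<union> branch_right ` (S n \<times> {..n})"
  proof
    fix M assume MS: "M \<in> S n"
    show "M \<in> ?e ` {..n} \<union> branch_right ` (S n \<times> {..n})"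
    proof (cases "M \<in> range ?e")
      case True then show ?thesis using MS by (auto simp: S_def)
    next
      case False
      then have "M \<in> branch_right ` (SL2_nonneg \<times> UNIV)"
        using MS bij_betw_branch_right by (auto simp: S_def bij_betw_def)
      then obtain a b c d k where M0: "(a, b, c, d) \<in> SL2_nonneg"
        and M: "M = (a + k * (a + c), b + k * (b + d), a + c, b + d)"
        by (rule branch_rightE)
      have "a > 0" using SL2_nonneg_pos M0 by blast
      then have "k \<le> k * (a + c)" by simp
      moreover have "a + k * (a + c) + (b + k * (b + d)) + (a + c) + (b + d) \<le> n"
        using MS M by (simp add: S_def)
      ultimately have "k \<le> n" "a + b + c + d \<le> n" by linarith+
      then have "((a, b, c, d), k) \<in> S n \<times> {..n}" using M0 by (auto simp: S_def)
      then show ?thesis using M by (force simp: branch_right_def)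
    qed
  qed
  have "sum f (S n) \<le> sum f (?e ` {..n} \<union> branch_right ` (S n \<times> {..n}))"
  proof (rule sum_mono2)
    fix M assume "M \<in> ?e ` {..n} \<union> branch_right ` (S n \<times> {..n}) - S n"
    then have "M \<in> SL2_nonneg" using e bR unfolding S_def by blast
    then show "0 \<le> f M" by (rule nonneg)
  qed (use sub fin in auto)
  also have "\<dots> \<le> sum f (?e ` {..n}) + sum f (branch_right ` (S n \<times> {..n}))"
  proof (subst sum_Un)
    show "sum f (?e ` {..n}) + sum f (branch_right ` (S n \<times> {..n}))
        - sum f (?e ` {..n} \<inter> branch_right ` (S n \<times> {..n}))
      \<le> sum f (?e ` {..n}) + sum f (branch_right ` (S n \<times> {..n}))"
    proof -
      have "0 \<le> sum f (?e ` {..n} \<inter> branch_right ` (S n \<times> {..n}))"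
        by (rule sum_nonneg) (use e nonneg in blast)
      then show ?thesis by simp
    qed
  qed (use fin in auto)
  also have "sum f (?e ` {..n}) = (\<Sum>k\<le>n. f (?e k))"
    using inj_e by (subst sum.reindex) (auto simp: inj_on_def)
  also have "\<dots> \<le> q"
    by (rule finite_sum_le_has_sum[OF hq]) (use nonneg[OF e] in auto)
  also have "sum f (branch_right ` (S n \<times> {..n})) = (\<Sum>x\<in>S n \<times> {..n}. f (branch_right x))"
    using bij_betw_branch_right
    by (subst sum.reindex) (auto simp: bij_betw_def S_def intro: inj_on_subset)
  also have "\<dots> = (\<Sum>M\<in>S n. \<Sum>k\<le>n. f (branch_right (M, k)))"
    by (simp add: sum.cartesian_product)
  also have "\<dots> \<le> sum r (S n)"
  proof (rule sum_mono)
    fix M assume "M \<in> S n"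
    then have M: "M \<in> SL2_nonneg" by (simp add: S_def)
    show "(\<Sum>k\<le>n. f (branch_right (M, k))) \<le> r M"
      by (rule finite_sum_le_has_sum[OF hr[OF M]]) (use M nonneg bR in auto)
  qed
  finally show "sum f (S n) \<le> q + sum r (S n)" by simp
  assume fs: "(f has_sum s) SL2_nonneg"
  have "(f has_sum q) (range ?e)"
    using hq inj_e by (subst has_sum_reindex) (auto simp: o_def)
  then have "(f has_sum (s - q)) (SL2_nonneg - range ?e)"
    using fs e by (intro has_sum_Diff) auto
  then have "((\<lambda>x. f (branch_right x)) has_sum (s - q)) (SL2_nonneg \<times> UNIV)"
    using has_sum_reindex_bij_betw[OF bij_betw_branch_right] by blast
  then show "(r has_sum (s - q)) SL2_nonneg"
    using hr by (rule has_sum_SigmaD) auto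
qed

text \<open>Adding the truncated inequalities of the two branches gives
  \<open>2 s \<le> p + q + s\<close> for each truncated sum \<open>s\<close>, hence boundedness and
  summability. Only then are the branch sums exact, and \<open>2 s = p + q + s\<close> can be solved
  for the total.\<close>

theorem has_sum_of_branches:
  fixes f r l :: "nat \<times> nat \<times> nat \<times> nat \<Rightarrow> real"
  assumes nonneg: "\<And>M. M \<in> SL2_nonneg \<Longrightarrow> 0 \<le> f M"
    and r: "\<And>M. M \<in> SL2_nonneg \<Longrightarrow> (\<lambda>k. f (branch_right (M, k))) sums r M"
    and l: "\<And>M. M \<in> SL2_nonneg \<Longrightarrow>
        (\<lambda>k. f (antitranspose (branch_right (antitranspose M, k)))) sums l M"
    and lr: "\<And>M. M \<in> SL2_nonneg \<Longrightarrow> l M + r M = f M"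
    and q: "(\<lambda>k. f (1, k, 0, 1)) sums q"
    and p: "(\<lambda>k. f (1, 0, k, 1)) sums p"
  shows "(f has_sum (p + q)) SL2_nonneg"
proof -
  define S where "S n = {M \<in> SL2_nonneg. (case M of (a, b, c, d) \<Rightarrow> a + b + c + d) \<le> n}" for n
  define f' where "f' M = f (antitranspose M)" for M
  define l' where "l' M = l (antitranspose M)" for M
  have tt [simp]: "antitranspose (antitranspose M) = M" for M
    by (cases M) (simp add: antitranspose_def)
  have tS: "antitranspose M \<in> SL2_nonneg" if "M \<in> SL2_nonneg" for M
    using bij_betw_antitranspose that by (auto simp: bij_betw_def)
  have bS: "bij_betw antitranspose (S n) (S n)" for n
    by (rule bij_betwI[where g = antitranspose])
       (use tS in \<open>auto simp: S_def antitranspose_def split: prod.splits\<close>)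
  have f': "0 \<le> f' M" "(\<lambda>k. f' (branch_right (M, k))) sums l' M" if "M \<in> SL2_nonneg" for M
    using nonneg[OF tS[OF that]] l[OF tS[OF that]] by (auto simp: f'_def l'_def)
  have p': "(\<lambda>k. f' (1, k, 0, 1)) sums p"
    using p by (simp add: f'_def antitranspose_def)
  have sum': "sum f' (S n) = sum f (S n)" "sum l' (S n) = sum l (S n)" for n
    using sum.reindex_bij_betw[OF bS] by (simp_all add: f'_def l'_def)
  have bound: "sum f (S n) \<le> p + q" for n
  proof -
    have "sum f (S n) \<le> q + sum r (S n)"
      using branch_right_sum_le[OF nonneg r q] unfolding S_def .
    moreover have "sum f (S n) \<le> p + sum l (S n)"
      using branch_right_sum_le[OF f' p', of n] sum'[of n] unfolding S_def by simp
    moreover have "sum l (S n) + sum r (S n) = sum f (S n)"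
      unfolding sum.distrib[symmetric] using lr by (intro sum.cong) (auto simp: S_def)
    ultimately show ?thesis by simp
  qed
  have "f summable_on SL2_nonneg"
  proof (rule nonneg_bdd_above_summable_on[OF nonneg])
    show "bdd_above (sum f ` {F. F \<subseteq> SL2_nonneg \<and> finite F})"
    proof (rule bdd_aboveI2)
      fix F assume F: "F \<in> {F. F \<subseteq> SL2_nonneg \<and> finite F}"
      define n where "n = (\<Sum>M\<in>F. case M of (a, b, c, d) \<Rightarrow> a + b + c + d)"
      have "F \<subseteq> S n"
        using F member_le_sum[of _ F "\<lambda>M. case M of (a, b, c, d) \<Rightarrow> a + b + c + d"]
        by (auto simp: S_def n_def)
      then have "sum f F \<le> sum f (S n)"
        using finite_SL2_bounded nonneg by (auto intro!: sum_mono2 simp: S_def)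
      then show "sum f F \<le> p + q" using bound[of n] by simp
    qed
  qed
  then obtain s where s: "(f has_sum s) SL2_nonneg" by (auto simp: summable_on_def)
  have s': "(f' has_sum s) SL2_nonneg"
    using s has_sum_reindex_bij_betw[OF bij_betw_antitranspose, of f] by (simp add: f'_def[abs_def])
  have "(r has_sum (s - q)) SL2_nonneg"
    using branch_right_has_sum[OF nonneg r q s] .
  moreover have "(l' has_sum (s - p)) SL2_nonneg"
    using branch_right_has_sum[OF f' p' s'] .
  then have "(l has_sum (s - p)) SL2_nonneg"
    using has_sum_reindex_bij_betw[OF bij_betw_antitranspose, of l] by (simp add: l'_def[abs_def])
  ultimately have "((\<lambda>M. l M + r M) has_sum (s - p + (s - q))) SL2_nonneg"
    by (intro has_sum_add)
  then have "(f has_sum (s - p + (s - q))) SL2_nonneg"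
    using lr by (subst has_sum_cong[of _ f "\<lambda>M. l M + r M"]) auto
  then have "s = s - p + (s - q)" using s has_sum_unique by blast
  then show ?thesis using s by (simp add: algebra_simps)
qed

section \<open>Crossing matrices of superadditive functions\<close>

lemma SL2_nonneg_coordinates:
  assumes "(a, b, c, d) \<in> SL2_nonneg"
  obtains i j :: int where "int x = i * int a + j * int c" "int y = i * int b + j * int d"
proof
  have det: "int a * int d - int b * int c = 1" using assms by (simp add: SL2_nonneg_def)
  let ?i = "int x * int d - int y * int c" and ?j = "int a * int y - int b * int x"
  have "?i * int a + ?j * int c = int x * (int a * int d - int b * int c)"
    "?i * int b + ?j * int d = int y * (int a * int d - int b * int c)"
    by (simp_all add: algebra_simps)
  then show "int x = ?i * int a + ?j * int c" "int y = ?i * int b + ?j * int d"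
    using det by simp_all
qed

text \<open>In the application \<open>\<phi>\<close> is the support number minus the value at a
  point \<open>z\<close>. It is positive for the normals whose tangent has \<open>z\<close> strictly
  on the side away from the curve.\<close>

locale superadditive =
  fixes \<phi> :: "nat \<Rightarrow> nat \<Rightarrow> real"
  assumes superadd: "\<phi> a b + \<phi> c d \<le> \<phi> (a + c) (b + d)"
    and homogeneous: "\<phi> (k * a) (k * b) = real k * \<phi> a b"
begin

definition crossing :: "nat \<times> nat \<times> nat \<times> nat \<Rightarrow> bool" where
  "crossing = (\<lambda>(a, b, c, d). \<phi> a b \<le> 0 \<and> \<phi> c d \<le> 0 \<and> 0 < \<phi> (a + c) (b + d))"

text \<open>Subtractive Euclidean algorithm on the coordinates \<open>(i, j)\<close> of a vector
  with positive value. If the mediant has a nonpositive value, it can replace one of the rows; the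
  coordinates become \<open>(i - j, j)\<close> or \<open>(i, j - i)\<close>, and
  \<open>i + j\<close> drops.\<close>

lemma crossing_exists:
  assumes "(a, b, c, d) \<in> SL2_nonneg" "\<phi> a b \<le> 0" "\<phi> c d \<le> 0"
    and "0 < \<phi> (i * a + j * c) (i * b + j * d)"
  shows "\<exists>M \<in> SL2_nonneg. crossing M"
  using assms
proof (induction "i + j" arbitrary: a b c d i j rule: less_induct)
  case less
  have pos: "0 < \<phi> (i * a + j * c) (i * b + j * d)" by fact
  \<comment> \<open>Otherwise the positive vector would be a multiple of one row, where homogeneity
    gives a nonpositive value.\<close>
  have ij: "i > 0" "j > 0"
  proof -
    show "i > 0"
    proof (rule gr0I)
      assume "i = 0"
      then show False using pos homogeneous[of j c d] less.prems(3)
        by (simp add: zero_less_mult_iff not_less)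
    qed
    show "j > 0"
    proof (rule gr0I)
      assume "j = 0"
      then show False using pos homogeneous[of i a b] less.prems(2)
        by (simp add: zero_less_mult_iff not_less)
    qed
  qed
  show ?case
  proof (cases "0 < \<phi> (a + c) (b + d)")
    case True
    then show ?thesis using less.prems by (intro bexI[of _ "(a, b, c, d)"]) (auto simp: crossing_def)
  next
    case False
    show ?thesis
    proof (cases "j \<le> i")
      case True
      have e: "i * a + j * c = (i - j) * a + j * (a + c)" "i * b + j * d = (i - j) * b + j * (b + d)"
        using le_Suc_ex[OF True] by (auto simp: algebra_simps)
      show ?thesis
      proof (rule less.hyps[of "i - j" j a b "a + c" "b + d"])
        show "(a, b, a + c, b + d) \<in> SL2_nonneg"
          using less.prems(1) by (auto simp: SL2_nonneg_iff algebra_simps)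
      qed (use ij True False less.prems pos e in auto)
    next
      case jf: False
      then have "i \<le> j" by simp
      then have e: "i * a + j * c = i * (a + c) + (j - i) * c" "i * b + j * d = i * (b + d) + (j - i) * d"
        using le_Suc_ex[of i j] by (auto simp: algebra_simps)
      show ?thesis
      proof (rule less.hyps[of i "j - i" "a + c" "b + d" c d])
        show "(a + c, b + d, c, d) \<in> SL2_nonneg"
          using less.prems(1) by (auto simp: SL2_nonneg_iff algebra_simps)
      qed (use ij jf False less.prems pos e in auto)
    qed
  qed
qed

text \<open>The set where \<open>\<phi>\<close> is positive is a convex cone containing the mediant but not the two rows
  of a crossing matrix, so it lies strictly between the rows.\<close>

lemma crossing_coordinates_pos:
  assumes M: "(a, b, c, d) \<in> SL2_nonneg" and cr: "crossing (a, b, c, d)" and pos: "0 < \<phi> x y"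
    and i: "int x = i * int a + j * int c" and j: "int y = i * int b + j * int d"
  shows "0 < i" "0 < j"
proof -
  have cr: "\<phi> a b \<le> 0" "\<phi> c d \<le> 0" "0 < \<phi> (a + c) (b + d)"
    using cr by (auto simp: crossing_def)
  have det: "int a * int d - int b * int c = 1" using M by (simp add: SL2_nonneg_def)
  have ij: "i = int x * int d - int y * int c" "j = int a * int y - int b * int x"
  proof -
    have "int x * int d - int y * int c = i * (int a * int d - int b * int c)"
      "int a * int y - int b * int x = j * (int a * int d - int b * int c)"
      using i j by (simp_all add: algebra_simps)
    then show "i = int x * int d - int y * int c" "j = int a * int y - int b * int x"
      using det by simp_all
  qed
  have False if le: "i \<le> 0"
  proof -
    \<comment> \<open>For rows \<open>v\<close>, \<open>w\<close> and mediant \<open>u\<close>,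
      adding \<open>-i\<close> copies of \<open>u\<close> to \<open>(x, y)\<close> cancels the
      \<open>v\<close>-coordinate and leaves \<open>(j - i) w\<close>. Superadditivity would make
      the value there positive.\<close>
    define n where "n = nat (- i)"
    have n: "int n = - i" using le by (simp add: n_def)
    have "j > 0"
    proof (rule ccontr)
      assume "\<not> j > 0"
      then have "int x \<le> 0" "int y \<le> 0"
        using i j le by (auto simp: mult_nonpos_nonneg add_nonpos_nonpos)
      then have "\<phi> x y = 0" using homogeneous[of 0 0 0] by simp
      then show False using pos by simp
    qed
    define m where "m = nat (j - i)"
    have m: "int m = j - i" "m > 0" using le \<open>j > 0\<close> by (auto simp: m_def)
    have "i = - int n" "j = int m - int n" using m n by simp_all
    then have "int (m * c) = int (n * (a + c) + x)" "int (m * d) = int (n * (b + d) + y)"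
      using i j by (simp_all only: of_nat_add of_nat_mult) (simp_all only: algebra_simps)
    then have e: "m * c = n * (a + c) + x" "m * d = n * (b + d) + y"
      by (simp_all only: of_nat_eq_iff)
    have "\<phi> (n * (a + c)) (n * (b + d)) + \<phi> x y \<le> \<phi> (m * c) (m * d)"
      unfolding e by (rule superadd)
    then have "real n * \<phi> (a + c) (b + d) + \<phi> x y \<le> real m * \<phi> c d"
      by (simp only: homogeneous)
    moreover have "0 \<le> real n * \<phi> (a + c) (b + d)" using cr by simp
    moreover have "real m * \<phi> c d \<le> 0" using cr by (simp add: mult_nonneg_nonpos)
    ultimately show False using pos by simp
  qed
  then show "0 < i" by force
  have False if le: "j \<le> 0"
  proof -
    define n where "n = nat (- j)"
    have n: "int n = - j" using le by (simp add: n_def)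
    define m where "m = nat (i - j)"
    have m: "int m = i - j" "m > 0" using le \<open>i > 0\<close> by (auto simp: m_def)
    have "j = - int n" "i = int m - int n" using m n by simp_all
    then have "int (m * a) = int (n * (a + c) + x)" "int (m * b) = int (n * (b + d) + y)"
      using i j by (simp_all only: of_nat_add of_nat_mult) (simp_all only: algebra_simps)
    then have e: "m * a = n * (a + c) + x" "m * b = n * (b + d) + y"
      by (simp_all only: of_nat_eq_iff)
    have "\<phi> (n * (a + c)) (n * (b + d)) + \<phi> x y \<le> \<phi> (m * a) (m * b)"
      unfolding e by (rule superadd)
    then have "real n * \<phi> (a + c) (b + d) + \<phi> x y \<le> real m * \<phi> a b"
      by (simp only: homogeneous)
    moreover have "0 \<le> real n * \<phi> (a + c) (b + d)" using cr by simp
    moreover have "real m * \<phi> a b \<le> 0" using cr by (simp add: mult_nonneg_nonpos)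
    ultimately show False using pos by simp
  qed
  then show "0 < j" by force
qed

text \<open>Both coordinates of \<open>(x, y)\<close> in the basis of rows are at least one. So the
  mediant of a crossing is the least vector with positive value.\<close>

lemma crossing_mediant_le:
  assumes M: "(a, b, c, d) \<in> SL2_nonneg" and cr: "crossing (a, b, c, d)" and pos: "0 < \<phi> x y"
  shows "a + c \<le> x" "b + d \<le> y"
proof -
  obtain i j where ij: "int x = i * int a + j * int c" "int y = i * int b + j * int d"
    using SL2_nonneg_coordinates[OF M] .
  have "1 \<le> i" "1 \<le> j" using crossing_coordinates_pos[OF M cr pos ij] by simp_all
  then have "1 * int a \<le> i * int a" "1 * int b \<le> i * int b" "1 * int c \<le> j * int c" "1 * int d \<le> j * int d"
    by (intro mult_right_mono; simp)+
  then show "a + c \<le> x" "b + d \<le> y" using ij by linarith+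
qed

text \<open>Minimality gives both crossings the same mediant \<open>u\<close>. First rows with the
  same mediant and determinant one differ by a multiple of \<open>u\<close>, and the bounds
  \<open>0 \<le> b' < b + d\<close> leave only the multiple zero.\<close>

lemma crossing_unique:
  assumes M: "(a, b, c, d) \<in> SL2_nonneg" and cr: "crossing (a, b, c, d)"
    and M': "(a', b', c', d') \<in> SL2_nonneg" and cr': "crossing (a', b', c', d')"
  shows "(a, b, c, d) = (a', b', c', d')"
proof -
  have pos: "0 < \<phi> (a + c) (b + d)" "0 < \<phi> (a' + c') (b' + d')"
    using cr cr' by (auto simp: crossing_def)
  have e: "a + c = a' + c'" "b + d = b' + d'"
    using crossing_mediant_le[OF M cr pos(2)] crossing_mediant_le[OF M' cr' pos(1)] by auto
  obtain i j where ij: "int a' = i * int a + j * int c" "int b' = i * int b + j * int d"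
    using SL2_nonneg_coordinates[OF M] .
  have pos4: "a > 0" "d > 0" "a' > 0" "d' > 0" using SL2_nonneg_pos M M' by blast+
  have det: "int a * int d - int b * int c = 1" "int a' * int d' - int b' * int c' = 1"
    using M M' by (auto simp: SL2_nonneg_def)
  have c': "int c' = int a + int c - int a'" "int d' = int b + int d - int b'" using e by linarith+
  have "1 = int a' * (int b + int d) - int b' * (int a + int c)"
    using det(2) unfolding c' by (simp add: algebra_simps)
  also have "\<dots> = (i - j) * (int a * int d - int b * int c)"
    unfolding ij by (simp add: algebra_simps)
  finally have i: "i = j + 1" using det by simp
  have a'b': "int a' = int a + j * int (a + c)" "int b' = int b + j * int (b + d)"
    using ij i by (simp_all add: algebra_simps)
  have less: "int b' < int (b + d)" using e pos4 by auto
  have "j = 0"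
  proof -
    have "j \<le> 0"
    proof (rule ccontr)
      assume "\<not> j \<le> 0"
      then have "1 * int (b + d) \<le> j * int (b + d)" by (intro mult_right_mono) auto
      also have "\<dots> = int b' - int b" using a'b' by simp
      finally show False using less by simp
    qed
    moreover have "0 \<le> j"
    proof (rule ccontr)
      assume "\<not> 0 \<le> j"
      then have "j * int (b + d) \<le> (-1) * int (b + d)" by (intro mult_right_mono) auto
      moreover have "j * int (b + d) = int b' - int b" using a'b' by simp
      ultimately show False using pos4 by simp
    qed
    ultimately show ?thesis by simp
  qed
  then show ?thesis using a'b' e by simp
qed

end

subsection \<open>Tangent lines\<close>

definition det2 :: "real^2 \<Rightarrow> real^2 \<Rightarrow> real" where
  "det2 u v = u$1 * v$2 - u$2 * v$1"

lemma inner_real2: "u \<bullet> v = u$1 * v$1 + u$2 * v$2" for u v :: "real^2"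
  by (simp add: inner_vec_def sum_2)

lemma det2_scaleR_expand:
  "det2 n m *\<^sub>R u = (n \<bullet> u) *\<^sub>R vector [m$2, - m$1] + (m \<bullet> u) *\<^sub>R vector [- n$2, n$1]"
  by (simp add: vec_eq_iff forall_2 inner_real2 det2_def algebra_simps)

lemma norm_rotate: "norm (vector [m$2, - m$1] :: real^2) = norm m" "norm (vector [- m$2, m$1] :: real^2) = norm m"
  for m :: "real^2"
  by (simp_all add: norm_eq_sqrt_inner inner_real2 algebra_simps)

text \<open>Quantitative Cramer's rule: a vector that is nearly orthogonal to two independent
  normals must be small.\<close>

lemma abs_det2_norm_le: "\<bar>det2 n m\<bar> * norm u \<le> \<bar>n \<bullet> u\<bar> * norm m + \<bar>m \<bullet> u\<bar> * norm n"
proof -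
  have "\<bar>det2 n m\<bar> * norm u = norm (det2 n m *\<^sub>R u)" by simp
  also have "\<dots> \<le> norm ((n \<bullet> u) *\<^sub>R vector [m$2, - m$1] :: real^2) + norm ((m \<bullet> u) *\<^sub>R vector [- n$2, n$1] :: real^2)"
    unfolding det2_scaleR_expand by (rule norm_triangle_ineq)
  also have "\<dots> = \<bar>n \<bullet> u\<bar> * norm m + \<bar>m \<bullet> u\<bar> * norm n"
    by (simp add: norm_rotate)
  finally show ?thesis .
qed

lemma det2_eq_0_imp_scaleR:
  assumes "det2 n m = 0" "n \<noteq> 0"
  obtains c where "m = c *\<^sub>R n"
proof
  have "n \<bullet> n \<noteq> 0" using assms by simp
  moreover have "(n \<bullet> n) *\<^sub>R m = (n \<bullet> m) *\<^sub>R n"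
  proof -
    have e: "n$1 * m$2 = n$2 * m$1" using assms by (simp add: det2_def)
    have "(n$1 * n$1 + n$2 * n$2) * m$1 = (n$1 * m$1 + n$2 * m$2) * n$1"
      "(n$1 * n$1 + n$2 * n$2) * m$2 = (n$1 * m$1 + n$2 * m$2) * n$2"
      using e by algebra+
    then show ?thesis by (simp add: vec_eq_iff forall_2 inner_real2)
  qed
  ultimately have "(n \<bullet> n) *\<^sub>R m = (n \<bullet> n) *\<^sub>R ((n \<bullet> m) / (n \<bullet> n)) *\<^sub>R n" by simp
  then show "m = ((n \<bullet> m) / (n \<bullet> n)) *\<^sub>R n"
    using \<open>n \<bullet> n \<noteq> 0\<close> by (simp only: real_vector.scale_cancel_left) simp
qed

lemma tangent_line_atE:
  assumes T: "tangent_line_at \<Gamma> t L"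
  obtains n where "n \<noteq> 0" "L = {z. n \<bullet> z = n \<bullet> \<Gamma> t}"
proof -
  have aff: "affine L" "aff_dim L = 1" and mem: "\<Gamma> t \<in> L"
    using T by (auto simp: tangent_line_at_def)
  then obtain n c where n: "n \<noteq> 0" "affine hull L = {z. n \<bullet> z = c}"
    using aff_dim_eq_hyperplane[of L] by auto
  have "L = {z. n \<bullet> z = c}" using n aff by (metis affine_hull_eq)
  with mem n(1) show ?thesis by (intro that[of n]) auto
qed

text \<open>The distance to \<open>L\<close> is the inner product with the normal divided by
  \<open>norm n\<close>, up to sign, so the limit in the definition becomes an estimate relative to
  the length of the secant.\<close>

lemma tangent_line_at_small:
  assumes T: "tangent_line_at \<Gamma> t L" and L: "L = {z. n \<bullet> z = n \<bullet> \<Gamma> t}" and n: "n \<noteq> 0"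
    and eta: "\<eta> > 0" and inj: "inj_on \<Gamma> {0..1}" and t: "t \<in> {0..1}"
  obtains \<delta> where "\<delta> > 0"
    "\<And>s. s \<in> {0..1} \<Longrightarrow> s \<noteq> t \<Longrightarrow> \<bar>s - t\<bar> < \<delta> \<Longrightarrow> \<bar>n \<bullet> (\<Gamma> s - \<Gamma> t)\<bar> < \<eta> * norm (\<Gamma> s - \<Gamma> t)"
proof -
  have lim: "((\<lambda>s. infdist (\<Gamma> s) L / dist (\<Gamma> s) (\<Gamma> t)) \<longlongrightarrow> 0) (at t within {0..1})"
    and mem: "\<Gamma> t \<in> L"
    using T by (auto simp: tangent_line_at_def)
  have "\<eta> / norm n > 0" using eta n by simp
  from tendstoD[OF lim this] obtain \<delta> where \<delta>: "\<delta> > 0"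
    "\<And>s. s \<in> {0..1} \<Longrightarrow> s \<noteq> t \<Longrightarrow> dist s t < \<delta> \<Longrightarrow>
      dist (infdist (\<Gamma> s) L / dist (\<Gamma> s) (\<Gamma> t)) 0 < \<eta> / norm n"
    unfolding eventually_at by auto
  show ?thesis
  proof (rule that[OF \<delta>(1)])
    fix s assume s: "s \<in> {0..1}" "s \<noteq> t" "\<bar>s - t\<bar> < \<delta>"
    have ne: "\<Gamma> s \<noteq> \<Gamma> t" using inj s t by (auto dest: inj_onD)
    have *: "infdist (\<Gamma> s) L < \<eta> / norm n * dist (\<Gamma> s) (\<Gamma> t)"
    proof -
      have "\<bar>infdist (\<Gamma> s) L / dist (\<Gamma> s) (\<Gamma> t)\<bar> < \<eta> / norm n"
        using \<delta>(2)[of s] s by (simp add: dist_real_def)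
      then have "infdist (\<Gamma> s) L / dist (\<Gamma> s) (\<Gamma> t) < \<eta> / norm n" by (rule abs_less_iff[THEN iffD1, THEN conjunct1])
      then show ?thesis using ne by (simp add: pos_divide_less_eq)
    qed
    have "\<bar>n \<bullet> (\<Gamma> s - \<Gamma> t)\<bar> / norm n \<le> infdist (\<Gamma> s) L"
      unfolding infdist_notempty[OF ex_in_conv[THEN iffD1, OF exI, OF mem]]
    proof (rule cINF_greatest)
      fix y assume "y \<in> L"
      then have "n \<bullet> (\<Gamma> s - \<Gamma> t) = n \<bullet> (\<Gamma> s - y)" using L by (simp add: inner_diff_right)
      then have "\<bar>n \<bullet> (\<Gamma> s - \<Gamma> t)\<bar> \<le> norm n * dist (\<Gamma> s) y"
        using Cauchy_Schwarz_ineq2[of n "\<Gamma> s - y"] by (simp add: dist_norm)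
      then show "\<bar>n \<bullet> (\<Gamma> s - \<Gamma> t)\<bar> / norm n \<le> dist (\<Gamma> s) y"
        using n by (simp add: pos_divide_le_eq mult.commute)
    qed (use mem in auto)
    with * have "\<bar>n \<bullet> (\<Gamma> s - \<Gamma> t)\<bar> / norm n < \<eta> / norm n * dist (\<Gamma> s) (\<Gamma> t)" by simp
    then show "\<bar>n \<bullet> (\<Gamma> s - \<Gamma> t)\<bar> < \<eta> * norm (\<Gamma> s - \<Gamma> t)"
      using n by (simp add: field_simps dist_norm)
  qed
qed

lemma unit_interval_near:
  fixes t \<delta> :: real
  assumes "t \<in> {0..1}" "\<delta> > 0"
  obtains s where "s \<in> {0..1}" "s \<noteq> t" "\<bar>s - t\<bar> < \<delta>"
proof (cases "t < 1/2")
  case True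
  then show ?thesis using assms by (intro that[of "t + min (\<delta>/2) (1/4)"]) (auto simp: min_def)
next
  case False
  then show ?thesis using assms by (intro that[of "t - min (\<delta>/2) (1/4)"]) (auto simp: min_def)
qed

text \<open>If the normals of two tangents were independent, short secants would be almost
  orthogonal to both, which \<open>abs_det2_norm_le\<close> rules out.\<close>

lemma tangent_line_unique:
  assumes T1: "tangent_line_at \<Gamma> t L1" and T2: "tangent_line_at \<Gamma> t L2"
    and inj: "inj_on \<Gamma> {0..1}" and t: "t \<in> {0..1}"
  shows "L1 = L2"
proof -
  obtain n where n: "n \<noteq> 0" "L1 = {z. n \<bullet> z = n \<bullet> \<Gamma> t}" using tangent_line_atE[OF T1] .
  obtain m where m: "m \<noteq> 0" "L2 = {z. m \<bullet> z = m \<bullet> \<Gamma> t}" using tangent_line_atE[OF T2] .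
  have "det2 n m = 0"
  proof (rule ccontr)
    assume d: "det2 n m \<noteq> 0"
    \<comment> \<open>Chosen so that the two error terms add up to exactly
      \<open>\<bar>det2 n m\<bar>\<close> times the length of the secant.\<close>
    define \<eta> where "\<eta> = \<bar>det2 n m\<bar> / (norm m + norm n)"
    have nm: "norm m + norm n > 0" using n m by (simp add: add_pos_pos)
    have eta: "\<eta> > 0" using d nm by (simp add: \<eta>_def)
    obtain \<delta>1 where d1: "\<delta>1 > 0" "\<And>s. s \<in> {0..1} \<Longrightarrow> s \<noteq> t \<Longrightarrow> \<bar>s - t\<bar> < \<delta>1 \<Longrightarrow>
        \<bar>n \<bullet> (\<Gamma> s - \<Gamma> t)\<bar> < \<eta> * norm (\<Gamma> s - \<Gamma> t)"
      using tangent_line_at_small[OF T1 n(2,1) eta inj t] by blast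
    obtain \<delta>2 where d2: "\<delta>2 > 0" "\<And>s. s \<in> {0..1} \<Longrightarrow> s \<noteq> t \<Longrightarrow> \<bar>s - t\<bar> < \<delta>2 \<Longrightarrow>
        \<bar>m \<bullet> (\<Gamma> s - \<Gamma> t)\<bar> < \<eta> * norm (\<Gamma> s - \<Gamma> t)"
      using tangent_line_at_small[OF T2 m(2,1) eta inj t] by blast
    obtain s where s: "s \<in> {0..1}" "s \<noteq> t" "\<bar>s - t\<bar> < min \<delta>1 \<delta>2"
      using unit_interval_near[OF t, of "min \<delta>1 \<delta>2"] d1 d2 by auto
    let ?u = "\<Gamma> s - \<Gamma> t"
    have "\<bar>det2 n m\<bar> * norm ?u \<le> \<bar>n \<bullet> ?u\<bar> * norm m + \<bar>m \<bullet> ?u\<bar> * norm n"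
      by (rule abs_det2_norm_le)
    also have "\<dots> < (\<eta> * norm ?u) * norm m + (\<eta> * norm ?u) * norm n"
      using d1(2)[of s] d2(2)[of s] s n m by (intro add_strict_mono mult_strict_right_mono) auto
    also have "\<dots> = \<eta> * (norm m + norm n) * norm ?u" by (simp add: algebra_simps)
    also have "\<dots> = \<bar>det2 n m\<bar> * norm ?u" using nm by (simp add: \<eta>_def)
    finally show False by simp
  qed
  then obtain c where c: "m = c *\<^sub>R n" using det2_eq_0_imp_scaleR n by blast
  then show ?thesis using n m by auto
qed

text \<open>Otherwise the boundary of \<open>K\<close> would have a cusp at \<open>\<Gamma> t\<close>: moving from a point of \<open>K\<close> close
  to \<open>\<Gamma> t\<close> in the direction of \<open>L\<close> towards the supporting line, one meets the boundary at a point
  which is seen from \<open>\<Gamma> t\<close> under an angle with \<open>L\<close> that is bounded below.\<close>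

lemma supporting_line_is_tangent:
  fixes K :: "(real^2) set"
  assumes arc: "arc \<Gamma>" and t: "t \<in> {0..1}" and T: "tangent_line_at \<Gamma> t L"
    and K: "open K" "convex K" "K \<noteq> {}" and fr: "frontier K = path_image \<Gamma> \<union> E"
    and E: "compact E" "\<Gamma> t \<notin> E"
    and w: "w \<noteq> 0" "\<And>z. z \<in> K \<Longrightarrow> w \<bullet> \<Gamma> t \<le> w \<bullet> z"
  shows "L = {z. w \<bullet> z = w \<bullet> \<Gamma> t}"
proof -
  define P where "P = \<Gamma> t"
  have inj: "inj_on \<Gamma> {0..1}" and cont: "continuous_on {0..1} \<Gamma>"
    using arc by (auto simp: arc_def path_def)
  obtain n where n: "n \<noteq> 0" "L = {z. n \<bullet> z = n \<bullet> P}" using tangent_line_atE[OF T] by (auto simp: P_def)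
  have PK: "P \<in> closure K" using fr t by (auto simp: P_def frontier_def path_image_def)
  have wcl: "w \<bullet> P \<le> w \<bullet> z" if "z \<in> closure K" for z
  proof -
    have "closure K \<subseteq> {z. w \<bullet> z \<ge> w \<bullet> P}"
      by (rule closure_minimal) (use w in \<open>auto simp: P_def closed_halfspace_ge\<close>)
    then show ?thesis using that by auto
  qed
  have "det2 n w = 0"
  proof (rule ccontr)
    assume d: "det2 n w \<noteq> 0"
    \<comment> \<open>A direction vector of \<open>L\<close>, scaled so that moving by
      \<open>s\<close> along it changes the inner product with \<open>w\<close> by
      \<open>s\<close>.\<close>
    define r :: "real^2" where "r = (1 / det2 n w) *\<^sub>R vector [- n$2, n$1]"
    have "n \<bullet> vector [- n$2, n$1] = 0" "w \<bullet> vector [- n$2, n$1] = det2 n w"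
      by (simp_all add: inner_real2 det2_def algebra_simps)
    then have r: "n \<bullet> r = 0" "w \<bullet> r = 1" using d by (simp_all add: r_def)
    obtain k where k: "k \<in> K" "n \<bullet> (k - P) \<noteq> 0"
    proof -
      obtain k where k: "k \<in> K" using K by blast
      obtain e where e: "e > 0" "ball k e \<subseteq> K" using K(1) k by (meson openE)
      show ?thesis
      proof (cases "n \<bullet> (k - P) = 0")
        case True
        let ?k = "k + (e / (2 * norm n)) *\<^sub>R n"
        have "dist k ?k < e" using e n by (simp add: dist_norm)
        then have "?k \<in> K" using e by auto
        moreover have "n \<bullet> (?k - P) = n \<bullet> (k - P) + e / (2 * norm n) * (n \<bullet> n)"
          by (simp add: inner_diff_right inner_add_right)
        ultimately show ?thesis using that[of ?k] True e n by simp
      qed (use k that in blast)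
    qed
    define c where "c = w \<bullet> (k - P)"
    have c: "c \<ge> 0" using wcl[of k] k closure_subset by (auto simp: c_def inner_diff_right)
    \<comment> \<open>Bounds the length of \<open>k - P - s r\<close> for all \<open>s\<close> in
      \<open>[0, c + 1]\<close>.\<close>
    define M where "M = norm (k - P) + (c + 1) * norm r"
    have "k \<noteq> P" using k by auto
    then have M: "M > 0" using c by (simp add: M_def add_pos_nonneg)
    define \<eta> where "\<eta> = \<bar>n \<bullet> (k - P)\<bar> / M"
    have eta: "\<eta> > 0" using k M by (simp add: \<eta>_def)
    obtain \<delta> where \<delta>: "\<delta> > 0" "\<And>s. s \<in> {0..1} \<Longrightarrow> s \<noteq> t \<Longrightarrow> \<bar>s - t\<bar> < \<delta> \<Longrightarrow>
        \<bar>n \<bullet> (\<Gamma> s - P)\<bar> < \<eta> * norm (\<Gamma> s - P)"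
      using tangent_line_at_small[OF T _ n(1) eta inj t] n(2) unfolding P_def by blast
    \<comment> \<open>The part of the frontier not coming from parameters near \<open>t\<close>; by
      compactness it keeps a distance \<open>\<rho>\<close> from \<open>P\<close>.\<close>
    define Z where "Z = \<Gamma> ` ({0..1} - ball t \<delta>) \<union> E"
    have "compact ({0..1} - ball t \<delta>)" by (intro compact_diff) auto
    then have "compact (\<Gamma> ` ({0..1} - ball t \<delta>))"
      by (intro compact_continuous_image continuous_on_subset[OF cont]) auto
    then have "compact Z" using E by (simp add: Z_def compact_Un)
    moreover have "P \<notin> Z"
      using E t inj \<delta>(1) by (auto simp: Z_def P_def dest: inj_onD)
    ultimately obtain \<rho> where \<rho>: "\<rho> > 0" "\<And>z. z \<in> Z \<Longrightarrow> \<rho> \<le> dist P z"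
      using separate_point_closed[of Z P] compact_imp_closed by blast
    define \<epsilon> where "\<epsilon> = min 1 (\<rho> / (2 * M))"
    have eps: "0 < \<epsilon>" "\<epsilon> \<le> 1" "\<epsilon> * M < \<rho>"
    proof -
      show "0 < \<epsilon>" "\<epsilon> \<le> 1" using \<rho> M by (auto simp: \<epsilon>_def)
      have "\<epsilon> * M \<le> \<rho> / (2 * M) * M" using M by (intro mult_right_mono) (auto simp: \<epsilon>_def)
      also have "\<dots> < \<rho>" using M \<rho> by simp
      finally show "\<epsilon> * M < \<rho>" .
    qed
    \<comment> \<open>The path starts on the segment from \<open>P\<close> to \<open>k\<close>,
      inside \<open>K\<close>, and ends strictly beyond the supporting line. It runs parallel to
      \<open>L\<close>, so the inner product with \<open>n\<close> is constant on it, and the factor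
      \<open>\<epsilon>\<close> keeps it within \<open>\<rho>\<close> of \<open>P\<close>.\<close>
    define z where "z s = P + \<epsilon> *\<^sub>R (k - P - s *\<^sub>R r)" for s
    have z0: "z 0 \<in> K"
    proof (cases "\<epsilon> = 1")
      case True then show ?thesis using k by (simp add: z_def)
    next
      case False
      have "z 0 = (1 - \<epsilon>) *\<^sub>R P + \<epsilon> *\<^sub>R k" by (simp add: z_def algebra_simps)
      then have "z 0 \<in> open_segment P k"
        using eps False \<open>k \<noteq> P\<close> unfolding in_segment by (intro conjI exI[of _ \<epsilon>]) auto
      moreover have "open_segment P k \<subseteq> interior K"
        using in_interior_closure_convex_segment[of K k P] K k PK
        by (simp add: interior_open open_segment_commute)
      ultimately show ?thesis using interior_subset by blast
    qed
    have "w \<bullet> z (c + 1) = w \<bullet> P - \<epsilon>"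
      using r by (simp add: z_def inner_add_right inner_diff_right c_def algebra_simps)
    then have z1: "z (c + 1) \<notin> K" using wcl[of "z (c + 1)"] closure_subset eps by auto
    have "connected (z ` {0..c + 1})"
      unfolding z_def by (intro connected_continuous_image continuous_intros) auto
    moreover have "z 0 \<in> z ` {0..c + 1}" "z (c + 1) \<in> z ` {0..c + 1}" using c by auto
    ultimately have "z ` {0..c + 1} \<inter> frontier K \<noteq> {}"
      using z0 z1 by (intro connected_Int_frontier) blast+
    then obtain s where s: "0 \<le> s" "s \<le> c + 1" "z s \<in> frontier K" by auto
    have "norm (k - P - s *\<^sub>R r) \<le> norm (k - P) + norm (s *\<^sub>R r)" by (rule norm_triangle_ineq4)
    also have "\<dots> \<le> M" using s by (simp add: M_def mult_right_mono)
    finally have nz: "norm (z s - P) \<le> \<epsilon> * M" using eps by (simp add: z_def)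
    have iz: "n \<bullet> (z s - P) = \<epsilon> * (n \<bullet> (k - P))" using r by (simp add: z_def inner_diff_right)
    have "z s \<notin> Z" using \<rho>(2)[of "z s"] nz eps by (auto simp: dist_norm norm_minus_commute)
    moreover obtain s' where s': "s' \<in> {0..1}" "z s = \<Gamma> s'"
    proof -
      have "z s \<in> path_image \<Gamma>" using s(3) fr calculation by (auto simp: Z_def)
      then show ?thesis using that by (auto simp: path_image_def)
    qed
    ultimately have "s' \<in> ball t \<delta>" by (auto simp: Z_def)
    then have s'd: "\<bar>s' - t\<bar> < \<delta>" by (simp add: dist_real_def abs_minus_commute)
    have "s' \<noteq> t"
    proof
      assume "s' = t"
      then have "n \<bullet> (z s - P) = 0" using s' by (simp add: P_def)
      then show False using iz eps k by simp
    qed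
    then have "\<bar>n \<bullet> (z s - P)\<bar> < \<eta> * norm (z s - P)" using \<delta>(2)[of s'] s' s'd by simp
    also have "\<dots> \<le> \<eta> * (\<epsilon> * M)" using nz eta by (intro mult_left_mono) auto
    also have "\<dots> = \<bar>n \<bullet> (z s - P)\<bar>" using M eps unfolding iz by (simp add: \<eta>_def abs_mult)
    finally show False by simp
  qed
  then obtain c where c: "w = c *\<^sub>R n" using det2_eq_0_imp_scaleR n by blast
  then show ?thesis using n w by (auto simp: P_def)
qed

text \<open>Near the point of tangency the increase along \<open>n\<close> is of smaller order than
  the secant, while the decrease along the independent normal \<open>m\<close> is comparable to it.
  So the decrease wins for all positive weights.\<close>

lemma tangent_endpoint_not_min:
  assumes T: "tangent_line_at \<Gamma> t {z. n \<bullet> z = n \<bullet> \<Gamma> t}" and inj: "inj_on \<Gamma> {0..1}" and t: "t \<in> {0..1}"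
    and d: "det2 n m \<noteq> 0"
    and pos: "a > 0" "b > 0"
    and le: "\<And>s. s \<in> {0..1} \<Longrightarrow> n \<bullet> (\<Gamma> s - \<Gamma> t) \<ge> 0" "\<And>s. s \<in> {0..1} \<Longrightarrow> m \<bullet> (\<Gamma> s - \<Gamma> t) \<le> 0"
  obtains s where "s \<in> {0..1}" "a * (n \<bullet> (\<Gamma> s - \<Gamma> t)) + b * (m \<bullet> (\<Gamma> s - \<Gamma> t)) < 0"
proof -
  have n0: "n \<noteq> 0" using d by (auto simp: det2_def)
  define \<eta> where "\<eta> = \<bar>det2 n m\<bar> / (norm m + a / b * norm n)"
  have D: "norm m + a / b * norm n > 0" using pos n0 by (simp add: add_nonneg_pos)
  then have eta: "\<eta> > 0" using d by (simp add: \<eta>_def)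
  obtain \<delta> where \<delta>: "\<delta> > 0" "\<And>s. s \<in> {0..1} \<Longrightarrow> s \<noteq> t \<Longrightarrow> \<bar>s - t\<bar> < \<delta> \<Longrightarrow>
      \<bar>n \<bullet> (\<Gamma> s - \<Gamma> t)\<bar> < \<eta> * norm (\<Gamma> s - \<Gamma> t)"
    using tangent_line_at_small[OF T refl n0 eta inj t] by blast
  obtain s where s: "s \<in> {0..1}" "s \<noteq> t" "\<bar>s - t\<bar> < \<delta>" using unit_interval_near[OF t \<delta>(1)] .
  let ?u = "\<Gamma> s - \<Gamma> t"
  show ?thesis
  proof (rule that[OF s(1)], rule ccontr)
    assume "\<not> a * (n \<bullet> ?u) + b * (m \<bullet> ?u) < 0"
    then have "- (m \<bullet> ?u) \<le> a / b * (n \<bullet> ?u)" using pos by (simp add: field_simps)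
    then have 1: "\<bar>m \<bullet> ?u\<bar> \<le> a / b * (n \<bullet> ?u)" using le(2)[OF s(1)] by simp
    have nu: "n \<bullet> ?u < \<eta> * norm ?u" using \<delta>(2)[OF s] by simp
    have "\<bar>det2 n m\<bar> * norm ?u \<le> \<bar>n \<bullet> ?u\<bar> * norm m + \<bar>m \<bullet> ?u\<bar> * norm n"
      by (rule abs_det2_norm_le)
    also have "\<dots> \<le> (n \<bullet> ?u) * norm m + (a / b * (n \<bullet> ?u)) * norm n"
      using 1 le(1)[OF s(1)] by (intro add_mono mult_right_mono) auto
    also have "\<dots> = (n \<bullet> ?u) * (norm m + a / b * norm n)" by (simp add: algebra_simps)
    also have "\<dots> < \<eta> * norm ?u * (norm m + a / b * norm n)"
      using nu D by (rule mult_strict_right_mono)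
    also have "\<dots> = \<bar>det2 n m\<bar> * norm ?u" using D by (simp add: \<eta>_def)
    finally show False by simp
  qed
qed

subsection \<open>Support numbers of the curve\<close>

text \<open>Fixes witnesses for the existential parts of the definitions: the convex region
  \<open>K\<close> and the constants \<open>g\<close>, \<open>g'\<close> of the two end
  tangents.\<close>

locale concave_curve_with_normals =
  fixes \<Gamma> :: "real \<Rightarrow> real^2" and K :: "(real^2) set" and C :: "real^2"
    and \<alpha> \<beta> \<alpha>' \<beta>' g g' :: real
  assumes arc: "arc \<Gamma>"
    and tangents: "\<And>t. t \<in> {0..1} \<Longrightarrow> \<exists>L. tangent_line_at \<Gamma> t L"
    and no_segment: "\<And>x y. x \<noteq> y \<Longrightarrow> \<not> closed_segment x y \<subseteq> path_image \<Gamma>"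
    and K: "open K" "convex K" "bounded K" "K \<noteq> {}"
    and frontier_K: "frontier K = path_image \<Gamma> \<union> closed_segment (\<Gamma> 0) (\<Gamma> 1)"
    and det: "\<alpha> * \<beta>' - \<beta> * \<alpha>' = 1"
    and tangent_0: "tangent_line_at \<Gamma> 0 (eq_line \<alpha> \<beta> g)"
    and tangent_1: "tangent_line_at \<Gamma> 1 (eq_line \<alpha>' \<beta>' g')"
    and half_planes: "path_image \<Gamma> \<subseteq> half_plane_le \<alpha> \<beta> g \<inter> half_plane_le \<alpha>' \<beta>' g'"
    and C: "C \<in> eq_line \<alpha> \<beta> g" "C \<in> eq_line \<alpha>' \<beta>' g'"
    and triangle: "path_image \<Gamma> \<subseteq> convex hull {\<Gamma> 0, \<Gamma> 1, C}"
begin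

text \<open>The affine functions \<open>X\<close>, \<open>Y\<close> form an area-preserving coordinate system in which the two
  tangents become the coordinate axes, \<open>C\<close> the origin and \<open>\<Gamma>\<close> a curve in the positive quadrant
  from \<open>(0, p)\<close> to \<open>(q, 0)\<close>.\<close>

definition X :: "real^2 \<Rightarrow> real" where "X z = g - (\<alpha> * z$1 + \<beta> * z$2)"
definition Y :: "real^2 \<Rightarrow> real" where "Y z = g' - (\<alpha>' * z$1 + \<beta>' * z$2)"
definition lin :: "real \<Rightarrow> real \<Rightarrow> real^2 \<Rightarrow> real" where "lin a b z = a * X z + b * Y z"
definition normal :: "real \<Rightarrow> real \<Rightarrow> real^2" where
  "normal a b = vector [a * \<alpha> + b * \<alpha>', a * \<beta> + b * \<beta>']"
text \<open>Inverse of the coordinate map \<open>(X, Y)\<close>, by Cramer's rule with determinant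
  one.\<close>

definition pt :: "real \<Rightarrow> real \<Rightarrow> real^2" where
  "pt x y = vector [(g - x) * \<beta>' - (g' - y) * \<beta>, (g' - y) * \<alpha> - (g - x) * \<alpha>']"
definition p :: real where "p = Y (\<Gamma> 0)"
definition q :: real where "q = X (\<Gamma> 1)"

lemma X_pt [simp]: "X (pt x y) = x" and Y_pt [simp]: "Y (pt x y) = y"
proof -
  have "X (pt x y) = g - (g - x) * (\<alpha> * \<beta>' - \<beta> * \<alpha>')" "Y (pt x y) = g' - (g' - y) * (\<alpha> * \<beta>' - \<beta> * \<alpha>')"
    by (simp_all add: X_def Y_def pt_def algebra_simps)
  then show "X (pt x y) = x" "Y (pt x y) = y" using det by simp_all
qed

lemma pt_XY: "pt (X z) (Y z) = z"
proof -
  have "z$1 * (\<alpha> * \<beta>' - \<beta> * \<alpha>') = pt (X z) (Y z) $ 1" "z$2 * (\<alpha> * \<beta>' - \<beta> * \<alpha>') = pt (X z) (Y z) $ 2"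
    by (simp_all add: X_def Y_def pt_def algebra_simps)
  then show ?thesis using det by (simp add: vec_eq_iff forall_2)
qed

lemma eq_by_XY: "X z = X z' \<Longrightarrow> Y z = Y z' \<Longrightarrow> z = z'"
  by (metis pt_XY)

lemma X_lin: "X z = lin 1 0 z" and Y_lin: "Y z = lin 0 1 z"
  by (simp_all add: lin_def)

lemma lin_inner: "lin a b z = (a * g + b * g') - normal a b \<bullet> z"
  by (simp add: lin_def X_def Y_def normal_def inner_real2 algebra_simps)

lemma normal_nonzero:
  assumes "a \<noteq> 0 \<or> b \<noteq> 0"
  shows "normal a b \<noteq> 0"
proof
  assume "normal a b = 0"
  then have e: "a * \<alpha> + b * \<alpha>' = 0" "a * \<beta> + b * \<beta>' = 0"
    by (auto simp: normal_def vec_eq_iff forall_2)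
  have "a * (\<alpha> * \<beta>' - \<beta> * \<alpha>') = 0" "b * (\<alpha> * \<beta>' - \<beta> * \<alpha>') = 0" using e by algebra+
  then show False using det assms by simp
qed

lemma lin_combination: "u + v = 1 \<Longrightarrow> lin a b (u *\<^sub>R x + v *\<^sub>R y) = u * lin a b x + v * lin a b y"
proof -
  assume "u + v = 1"
  then have v: "v = 1 - u" by simp
  show ?thesis unfolding v by (simp add: lin_inner inner_add_right algebra_simps)
qed

lemma continuous_on_lin [continuous_intros]: "continuous_on S (lin a b)"
  unfolding lin_inner[abs_def] by (intro continuous_intros)

lemma lin_ge: "{z. c \<le> lin a b z} = {z. normal a b \<bullet> z \<le> a * g + b * g' - c}"
  and lin_le: "{z. lin a b z \<le> c} = {z. normal a b \<bullet> z \<ge> a * g + b * g' - c}"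
  and lin_eq: "{z. lin a b z = c} = {z. normal a b \<bullet> z = a * g + b * g' - c}"
  by (auto simp: lin_inner)

lemma convex_lin_ge: "convex {z. c \<le> lin a b z}" and convex_lin_le: "convex {z. lin a b z \<le> c}"
  unfolding lin_ge lin_le by (rule convex_halfspace_le convex_halfspace_ge)+

lemma negligible_lin_eq: "a \<noteq> 0 \<or> b \<noteq> 0 \<Longrightarrow> negligible {z. lin a b z = c}"
  unfolding lin_eq using normal_nonzero by (intro negligible_hyperplane) auto

lemma open_lin_less:
  assumes "open S" "\<And>z. z \<in> S \<Longrightarrow> c \<le> lin a b z" "a \<noteq> 0 \<or> b \<noteq> 0" "z \<in> S"
  shows "c < lin a b z"
proof -
  have "S \<subseteq> interior {z. c \<le> lin a b z}" using assms(1,2) by (intro interior_maximal) auto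
  moreover have "interior {z. c \<le> lin a b z} = {z. normal a b \<bullet> z < a * g + b * g' - c}"
    unfolding lin_ge using normal_nonzero[OF assms(3)] by (rule interior_halfspace_le)
  ultimately show ?thesis using assms(4) by (auto simp: lin_inner)
qed

abbreviation "G \<equiv> path_image \<Gamma>"
abbreviation "T \<equiv> convex hull {\<Gamma> 0, \<Gamma> 1, C}"

lemma G01: "\<Gamma> 0 \<in> G" "\<Gamma> 1 \<in> G" by (auto simp: path_image_def)

lemma compact_G: "compact G" using arc by (simp add: arc_imp_path compact_path_image)

lemma XY_vertices: "X (\<Gamma> 0) = 0" "Y (\<Gamma> 0) = p" "X (\<Gamma> 1) = q" "Y (\<Gamma> 1) = 0" "X C = 0" "Y C = 0"
  using tangent_0 tangent_1 C by (auto simp: tangent_line_at_def eq_line_def X_def Y_def p_def q_def)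

lemma G_nonneg: "z \<in> G \<Longrightarrow> 0 \<le> X z" "z \<in> G \<Longrightarrow> 0 \<le> Y z"
  using half_planes by (auto simp: half_plane_le_def X_def Y_def)

lemma pq_nonneg: "0 \<le> p" "0 \<le> q" using G_nonneg G01 by (auto simp: p_def q_def)

text \<open>A compact convex set is the convex hull of its frontier; here the frontier lies in the
  curve and the chord, both inside the support triangle.\<close>

lemma closure_K: "closure K \<subseteq> T" and closure_K_hull: "closure K \<subseteq> convex hull (G \<union> closed_segment (\<Gamma> 0) (\<Gamma> 1))"
proof -
  have "closure K = convex hull (frontier (closure K))"
    using K by (intro Krein_Milman_frontier) (auto simp: convex_closure)
  also have "\<dots> \<subseteq> convex hull (frontier K)"
    using interior_mono[OF closure_subset, of K] by (intro hull_mono) (auto simp: frontier_def)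
  finally show *: "closure K \<subseteq> convex hull (G \<union> closed_segment (\<Gamma> 0) (\<Gamma> 1))"
    using frontier_K by simp
  have "closed_segment (\<Gamma> 0) (\<Gamma> 1) \<subseteq> T"
    unfolding segment_convex_hull by (intro hull_mono) auto
  then have "convex hull (G \<union> closed_segment (\<Gamma> 0) (\<Gamma> 1)) \<subseteq> T"
    using triangle by (intro hull_minimal) auto
  with * show "closure K \<subseteq> T" by blast
qed

lemma K_subset_T: "K \<subseteq> T" using closure_K closure_subset by blast

lemma T_subset:
  assumes "c \<le> lin a b (\<Gamma> 0)" "c \<le> lin a b (\<Gamma> 1)" "c \<le> lin a b C" "z \<in> T"
  shows "c \<le> lin a b z"
proof -
  have "T \<subseteq> {z. c \<le> lin a b z}" using assms(1-3) convex_lin_ge by (intro hull_minimal) auto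
  then show ?thesis using assms(4) by blast
qed

text \<open>If \<open>p\<close> or \<open>q\<close> vanished, the support triangle would lie on a
  line and could not contain the nonempty open set \<open>K\<close>.\<close>

lemma pq_pos: "0 < p" "0 < q"
proof -
  obtain k where k: "k \<in> K" using K by blast
  have "p \<noteq> 0"
  proof
    assume "p = 0"
    have "0 \<le> lin 0 (-1) z" if "z \<in> K" for z
      by (rule T_subset) (use that \<open>p = 0\<close> K_subset_T XY_vertices in \<open>auto simp: lin_def\<close>)
    then have "0 < lin 0 (-1) k" using open_lin_less[OF K(1) _ _ k, of 0 0 "-1"] by auto
    moreover have "0 \<le> lin 0 1 k"
      by (rule T_subset) (use k K_subset_T XY_vertices \<open>p = 0\<close> in \<open>auto simp: lin_def\<close>)
    ultimately show False by (simp add: lin_def)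
  qed
  then show "0 < p" using pq_nonneg by simp
  have "q \<noteq> 0"
  proof
    assume "q = 0"
    have "0 \<le> lin (-1) 0 z" if "z \<in> K" for z
      by (rule T_subset) (use that \<open>q = 0\<close> K_subset_T XY_vertices in \<open>auto simp: lin_def\<close>)
    then have "0 < lin (-1) 0 k" using open_lin_less[OF K(1) _ _ k, of 0 "-1" 0] by auto
    moreover have "0 \<le> lin 1 0 k"
      by (rule T_subset) (use k K_subset_T XY_vertices \<open>q = 0\<close> in \<open>auto simp: lin_def\<close>)
    ultimately show False by (simp add: lin_def)
  qed
  then show "0 < q" using pq_nonneg by simp
qed

lemma T_iff: "z \<in> T \<longleftrightarrow> 0 \<le> X z \<and> 0 \<le> Y z \<and> p * X z + q * Y z \<le> p * q"
proof
  assume z: "z \<in> T"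
  have "0 \<le> lin 1 0 z" "0 \<le> lin 0 1 z" "- (p * q) \<le> lin (-p) (-q) z"
    by (rule T_subset; use z XY_vertices pq_pos in \<open>simp add: lin_def\<close>)+
  then show "0 \<le> X z \<and> 0 \<le> Y z \<and> p * X z + q * Y z \<le> p * q" by (simp add: lin_def)
next
  assume z: "0 \<le> X z \<and> 0 \<le> Y z \<and> p * X z + q * Y z \<le> p * q"
  \<comment> \<open>\<open>u\<close> and \<open>v\<close> are the barycentric coordinates of
    \<open>z\<close> at \<open>\<Gamma> 0\<close> and \<open>\<Gamma> 1\<close>.\<close>
  define u where "u = Y z / p"
  define v where "v = X z / q"
  have uv: "0 \<le> u" "0 \<le> v" "u + v \<le> 1"
    using z pq_pos by (auto simp: u_def v_def field_simps)
  have "z = u *\<^sub>R \<Gamma> 0 + v *\<^sub>R \<Gamma> 1 + (1 - u - v) *\<^sub>R C"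
  proof (rule eq_by_XY)
    have *: "lin a b (u *\<^sub>R \<Gamma> 0 + v *\<^sub>R \<Gamma> 1 + (1 - u - v) *\<^sub>R C)
        = u * lin a b (\<Gamma> 0) + v * lin a b (\<Gamma> 1) + (1 - u - v) * lin a b C" for a b
      by (simp add: lin_inner inner_add_right algebra_simps)
    show "X z = X (u *\<^sub>R \<Gamma> 0 + v *\<^sub>R \<Gamma> 1 + (1 - u - v) *\<^sub>R C)"
      using *[of 1 0] XY_vertices pq_pos by (simp add: lin_def v_def)
    show "Y z = Y (u *\<^sub>R \<Gamma> 0 + v *\<^sub>R \<Gamma> 1 + (1 - u - v) *\<^sub>R C)"
      using *[of 0 1] XY_vertices pq_pos by (simp add: lin_def u_def)
  qed
  then show "z \<in> T" unfolding convex_hull_3 using uv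
    by (intro CollectI exI[of _ u] exI[of _ v] exI[of _ "1 - u - v"]) auto
qed

section \<open>The support function and its minimisers\<close>

definition h :: "nat \<Rightarrow> nat \<Rightarrow> real" where
  "h a b = Inf (lin (real a) (real b) ` G)"

lemma h_min: "\<exists>z\<in>G. h a b = lin (real a) (real b) z \<and> (\<forall>y\<in>G. h a b \<le> lin (real a) (real b) y)"
proof -
  obtain z where z: "z \<in> G" "\<And>y. y \<in> G \<Longrightarrow> lin (real a) (real b) z \<le> lin (real a) (real b) y"
    using continuous_attains_inf[OF compact_G _ continuous_on_lin, of "real a" "real b"] G01 by blast
  then have "h a b = lin (real a) (real b) z"
    unfolding h_def by (intro cInf_eq_minimum) auto
  then show ?thesis using z by auto
qed

lemma h_le: "z \<in> G \<Longrightarrow> h a b \<le> lin (real a) (real b) z"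
  using h_min by blast

lemma h_attained:
  obtains t where "t \<in> {0..1}" "lin (real a) (real b) (\<Gamma> t) = h a b"
  using h_min[of a b] unfolding path_image_def by force

lemma h_eqI:
  assumes "z \<in> G" "lin (real a) (real b) z = c" "\<And>y. y \<in> G \<Longrightarrow> c \<le> lin (real a) (real b) y"
  shows "h a b = c"
  unfolding h_def using assms by (intro cInf_eq_minimum) auto

lemma h_axes: "h a 0 = 0" "h 0 b = 0"
proof -
  show "h a 0 = 0" by (rule h_eqI[of "\<Gamma> 0"]) (use XY_vertices G01 G_nonneg in \<open>auto simp: lin_def\<close>)
  show "h 0 b = 0" by (rule h_eqI[of "\<Gamma> 1"]) (use XY_vertices G01 G_nonneg in \<open>auto simp: lin_def\<close>)
qed

lemma h_superadd: "h a b + h c d \<le> h (a + c) (b + d)"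
proof -
  obtain t where t: "t \<in> {0..1}" "lin (real (a + c)) (real (b + d)) (\<Gamma> t) = h (a + c) (b + d)"
    by (rule h_attained)
  have "\<Gamma> t \<in> G" using t by (auto simp: path_image_def)
  then have "h a b + h c d \<le> lin (real a) (real b) (\<Gamma> t) + lin (real c) (real d) (\<Gamma> t)"
    by (intro add_mono h_le)
  also have "\<dots> = h (a + c) (b + d)" unfolding t(2)[symmetric] by (simp add: lin_def algebra_simps)
  finally show ?thesis .
qed

lemma h_homogeneous: "h (k * a) (k * b) = real k * h a b"
proof -
  obtain t where t: "t \<in> {0..1}" "lin (real a) (real b) (\<Gamma> t) = h a b" by (rule h_attained)
  have l: "lin (real (k * a)) (real (k * b)) z = real k * lin (real a) (real b) z" for z
    by (simp add: lin_def algebra_simps)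
  show ?thesis
  proof (rule h_eqI)
    show "\<Gamma> t \<in> G" using t by (auto simp: path_image_def)
    show "lin (real (k * a)) (real (k * b)) (\<Gamma> t) = real k * h a b" unfolding l t(2) ..
    show "real k * h a b \<le> lin (real (k * a)) (real (k * b)) y" if "y \<in> G" for y
      unfolding l using h_le[OF that] by (intro mult_left_mono) auto
  qed
qed

text \<open>At each end the curve is tangent to a coordinate axis. The coordinate that vanishes
  there grows to lower order than the other one decreases, so a positive combination drops below its
  end value.\<close>

lemma endpoint_not_min:
  assumes "0 < a" "0 < b"
  shows "h a b < lin (real a) (real b) (\<Gamma> 0)" "h a b < lin (real a) (real b) (\<Gamma> 1)"
proof -
  have inj: "inj_on \<Gamma> {0..1}" using arc by (simp add: arc_def)
  have el: "eq_line \<alpha> \<beta> g = {z. (- normal 1 0) \<bullet> z = (- normal 1 0) \<bullet> \<Gamma> 0}"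
    "eq_line \<alpha>' \<beta>' g' = {z. (- normal 0 1) \<bullet> z = (- normal 0 1) \<bullet> \<Gamma> 1}"
    using XY_vertices by (auto simp: eq_line_def normal_def inner_real2 X_def Y_def)
  have l: "(- normal 1 0) \<bullet> (z - y) = X z - X y" "(- normal 0 1) \<bullet> (z - y) = Y z - Y y" for z y
    using lin_inner[of 1 0] lin_inner[of 0 1] by (simp_all add: X_lin Y_lin inner_diff_right)
  have d: "det2 (- normal 1 0) (- normal 0 1) \<noteq> 0" "det2 (- normal 0 1) (- normal 1 0) \<noteq> 0"
    using det by (auto simp: det2_def normal_def algebra_simps)
  have G: "\<Gamma> s \<in> G" "\<Gamma> s \<in> T" if "s \<in> {0..1}" for s using that triangle by (auto simp: path_image_def)
  have XY: "X (\<Gamma> s) \<le> q" "Y (\<Gamma> s) \<le> p" if "s \<in> {0..1}" for s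
  proof -
    have t: "0 \<le> X (\<Gamma> s)" "0 \<le> Y (\<Gamma> s)" "p * X (\<Gamma> s) + q * Y (\<Gamma> s) \<le> p * q" using G[OF that] T_iff by auto
    have "0 \<le> p * X (\<Gamma> s)" "0 \<le> q * Y (\<Gamma> s)" using t pq_pos by auto
    then have "p * X (\<Gamma> s) \<le> p * q" "q * Y (\<Gamma> s) \<le> q * p" using t by (auto simp: mult.commute)
    then show "X (\<Gamma> s) \<le> q" "Y (\<Gamma> s) \<le> p" using pq_pos by simp_all
  qed
  obtain s where s: "s \<in> {0..1}" "real a * ((- normal 1 0) \<bullet> (\<Gamma> s - \<Gamma> 0)) + real b * ((- normal 0 1) \<bullet> (\<Gamma> s - \<Gamma> 0)) < 0"
  proof (rule tangent_endpoint_not_min[OF tangent_0[unfolded el] inj _ d(1), of "real a" "real b"])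
    show "0 \<le> - normal 1 0 \<bullet> (\<Gamma> s - \<Gamma> 0)" "- normal 0 1 \<bullet> (\<Gamma> s - \<Gamma> 0) \<le> 0" if "s \<in> {0..1}" for s
      unfolding l using G_nonneg G XY that XY_vertices by simp_all
  qed (use assms in auto)
  then have "lin (real a) (real b) (\<Gamma> s) < lin (real a) (real b) (\<Gamma> 0)"
    unfolding l by (simp add: lin_def algebra_simps)
  then show "h a b < lin (real a) (real b) (\<Gamma> 0)" using h_le[OF G(1)[OF s(1)], of a b] by simp
  obtain s where s: "s \<in> {0..1}" "real b * ((- normal 0 1) \<bullet> (\<Gamma> s - \<Gamma> 1)) + real a * ((- normal 1 0) \<bullet> (\<Gamma> s - \<Gamma> 1)) < 0"
  proof (rule tangent_endpoint_not_min[OF tangent_1[unfolded el] inj _ d(2), of "real b" "real a"])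
    show "0 \<le> - normal 0 1 \<bullet> (\<Gamma> s - \<Gamma> 1)" "- normal 1 0 \<bullet> (\<Gamma> s - \<Gamma> 1) \<le> 0" if "s \<in> {0..1}" for s
      unfolding l using G_nonneg G XY that XY_vertices by simp_all
  qed (use assms in auto)
  then have "lin (real a) (real b) (\<Gamma> s) < lin (real a) (real b) (\<Gamma> 1)"
    unfolding l by (simp add: lin_def algebra_simps)
  then show "h a b < lin (real a) (real b) (\<Gamma> 1)" using h_le[OF G(1)[OF s(1)], of a b] by simp
qed

text \<open>The function is affine on the chord. For positive \<open>a\<close> and \<open>b\<close>
  both end values exceed the minimum strictly; for a normal on an axis only the end point with value
  zero remains.\<close>

lemma chord_min:
  assumes "a \<noteq> 0 \<or> b \<noteq> 0" "z \<in> closed_segment (\<Gamma> 0) (\<Gamma> 1)" "lin (real a) (real b) z = h a b"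
  shows "a = 0 \<and> z = \<Gamma> 1 \<or> b = 0 \<and> z = \<Gamma> 0"
proof -
  obtain u where u: "0 \<le> u" "u \<le> 1" "z = (1 - u) *\<^sub>R \<Gamma> 0 + u *\<^sub>R \<Gamma> 1"
    using assms by (auto simp: in_segment)
  have l: "lin (real a) (real b) z = (1 - u) * lin (real a) (real b) (\<Gamma> 0) + u * lin (real a) (real b) (\<Gamma> 1)"
    unfolding u(3) by (rule lin_combination) simp
  consider "a = 0" "b > 0" | "b = 0" "a > 0" | "a > 0" "b > 0" using assms by blast
  then show ?thesis
  proof cases
    case 1
    then have "(1 - u) * p = 0" using l assms XY_vertices h_axes by (simp add: lin_def)
    then show ?thesis using u pq_pos 1 by simp
  next
    case 2
    then have "u * q = 0" using l assms XY_vertices h_axes by (simp add: lin_def)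
    then show ?thesis using u pq_pos 2 by simp
  next
    case 3
    note e = endpoint_not_min[OF 3]
    have "h a b = (1 - u) * h a b + u * h a b" by (simp add: algebra_simps)
    also have "\<dots> < lin (real a) (real b) z"
    proof (cases "u = 0")
      case True then show ?thesis using e l by simp
    next
      case False
      then show ?thesis unfolding l using e u by (intro add_le_less_mono mult_left_mono mult_strict_left_mono) auto
    qed
    finally show ?thesis using assms by simp
  qed
qed

lemma closure_K_ge:
  assumes "z \<in> closure K"
  shows "h a b \<le> lin (real a) (real b) z"
proof -
  have "closed_segment (\<Gamma> 0) (\<Gamma> 1) \<subseteq> {z. h a b \<le> lin (real a) (real b) z}"
    by (rule closed_segment_subset) (use h_le G01 convex_lin_ge in auto)
  then have "convex hull (G \<union> closed_segment (\<Gamma> 0) (\<Gamma> 1)) \<subseteq> {z. h a b \<le> lin (real a) (real b) z}"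
    using h_le by (intro hull_minimal convex_lin_ge) auto
  then show ?thesis using assms closure_K_hull by blast
qed

lemma K_greater:
  assumes "z \<in> K" "a \<noteq> 0 \<or> b \<noteq> 0"
  shows "h a b < lin (real a) (real b) z"
proof (rule open_lin_less[OF K(1) _ _ assms(1)])
  show "h a b \<le> lin (real a) (real b) y" if "y \<in> K" for y
    using that closure_subset by (intro closure_K_ge) blast
qed (use assms in auto)

text \<open>The segment joining two minimisers lies in \<open>closure K\<close> but misses the open
  set \<open>K\<close>, so it lies in the frontier. The chord contributes at most its end points, so
  the segment would lie on the curve.\<close>

lemma min_unique:
  assumes ab: "a \<noteq> 0 \<or> b \<noteq> 0" and z: "z \<in> G" "lin (real a) (real b) z = h a b"
    and z': "z' \<in> G" "lin (real a) (real b) z' = h a b"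
  shows "z = z'"
proof (rule ccontr)
  assume "z \<noteq> z'"
  have "closed_segment z z' \<subseteq> G"
  proof
    fix y assume y: "y \<in> closed_segment z z'"
    have "G \<subseteq> closure K" using frontier_K by (auto simp: frontier_def)
    then have "closed_segment z z' \<subseteq> closure K"
      using z z' K by (intro closed_segment_subset convex_closure) auto
    then have yc: "y \<in> closure K" using y by blast
    obtain u where u: "y = (1 - u) *\<^sub>R z + u *\<^sub>R z'" using y by (auto simp: in_segment)
    have ye: "lin (real a) (real b) y = h a b"
      unfolding u using z z' by (subst lin_combination) (auto simp: algebra_simps)
    then have "y \<notin> K" using K_greater[OF _ ab, of y] by auto
    then have "y \<in> frontier K" using yc K by (simp add: frontier_def interior_open)
    then show "y \<in> G" using frontier_K chord_min[OF ab _ ye] G01 by auto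
  qed
  then show False using no_segment \<open>z \<noteq> z'\<close> by blast
qed

lemma eq_line_lin:
  "eq_line (a * \<alpha> + b * \<alpha>') (a * \<beta> + b * \<beta>') c = {z. lin a b z = a * g + b * g' - c}"
  by (auto simp: eq_line_def lin_def X_def Y_def algebra_simps)

lemma half_plane_le_lin:
  "half_plane_le (a * \<alpha> + b * \<alpha>') (a * \<beta> + b * \<beta>') c = {z. a * g + b * g' - c \<le> lin a b z}"
  by (auto simp: half_plane_le_def lin_def X_def Y_def algebra_simps)

lemma half_plane_ge_lin:
  "half_plane_ge (a * \<alpha> + b * \<alpha>') (a * \<beta> + b * \<beta>') c = {z. lin a b z \<le> a * g + b * g' - c}"
  by (auto simp: half_plane_ge_def lin_def X_def Y_def algebra_simps)

text \<open>For the axes these are the given end tangents. For positive \<open>a\<close> and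
  \<open>b\<close> a minimiser is off the chord, and \<open>supporting_line_is_tangent\<close>
  identifies the level line supporting \<open>K\<close> with the tangent.\<close>

lemma tangent_at_min:
  assumes ab: "a \<noteq> 0 \<or> b \<noteq> 0"
  shows "\<exists>t\<in>{0..1}. tangent_line_at \<Gamma> t {z. lin (real a) (real b) z = h a b}"
proof -
  consider "a = 0" "b > 0" | "b = 0" "a > 0" | "a > 0" "b > 0" using ab by blast
  then show ?thesis
  proof cases
    case 1
    have "{z. lin (real a) (real b) z = h a b} = eq_line \<alpha>' \<beta>' g'"
      using 1 h_axes by (auto simp: lin_def eq_line_def Y_def)
    then show ?thesis using tangent_1 by auto
  next
    case 2
    have "{z. lin (real a) (real b) z = h a b} = eq_line \<alpha> \<beta> g"
      using 2 h_axes by (auto simp: lin_def eq_line_def X_def)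
    then show ?thesis using tangent_0 by auto
  next
    case 3
    obtain t where t: "t \<in> {0..1}" "lin (real a) (real b) (\<Gamma> t) = h a b" by (rule h_attained)
    obtain L where L: "tangent_line_at \<Gamma> t L" using tangents t by blast
    have "L = {z. (- normal a b) \<bullet> z = (- normal a b) \<bullet> \<Gamma> t}"
    proof (rule supporting_line_is_tangent[OF arc t(1) L K(1,2,4) frontier_K])
      show "\<Gamma> t \<notin> closed_segment (\<Gamma> 0) (\<Gamma> 1)" using chord_min[OF ab _ t(2)] 3 by auto
      show "- normal a b \<noteq> 0" using ab normal_nonzero[of "real a" "real b"] by simp
      show "- normal a b \<bullet> \<Gamma> t \<le> - normal a b \<bullet> z" if "z \<in> K" for z
        using K_greater[OF that ab] t(2) by (simp add: lin_inner)
    qed auto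
    also have "\<dots> = {z. lin (real a) (real b) z = h a b}"
      unfolding t(2)[symmetric] by (auto simp: lin_inner)
    finally show ?thesis using L t by auto
  qed
qed

text \<open>Resolves the definite description: existence is tangency at the minimiser, and a line
  touching the curve with the curve on one side must be the level line of the minimum.\<close>

lemma tangent_const_eq:
  assumes ab: "a \<noteq> 0 \<or> b \<noteq> 0"
  shows "tangent_const \<Gamma> \<alpha> \<beta> \<alpha>' \<beta>' a b = real a * g + real b * g' - h a b"
  unfolding tangent_const_def
proof (rule the_equality)
  show "(\<exists>t\<in>{0..1}. tangent_line_at \<Gamma> t
           (eq_line (real a * \<alpha> + real b * \<alpha>') (real a * \<beta> + real b * \<beta>') (real a * g + real b * g' - h a b))) \<and>
    G \<subseteq> half_plane_le (real a * \<alpha> + real b * \<alpha>') (real a * \<beta> + real b * \<beta>') (real a * g + real b * g' - h a b)"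
    unfolding eq_line_lin half_plane_le_lin using tangent_at_min[OF ab] h_le by auto
next
  fix c
  assume "(\<exists>t\<in>{0..1}. tangent_line_at \<Gamma> t
           (eq_line (real a * \<alpha> + real b * \<alpha>') (real a * \<beta> + real b * \<beta>') c)) \<and>
    G \<subseteq> half_plane_le (real a * \<alpha> + real b * \<alpha>') (real a * \<beta> + real b * \<beta>') c"
  then have ex: "\<exists>t\<in>{0..1}. lin (real a) (real b) (\<Gamma> t) = real a * g + real b * g' - c"
    and le: "\<And>z. z \<in> G \<Longrightarrow> real a * g + real b * g' - c \<le> lin (real a) (real b) z"
    unfolding eq_line_lin half_plane_le_lin tangent_line_at_def by blast+
  from ex obtain t where t: "t \<in> {0..1}" "lin (real a) (real b) (\<Gamma> t) = real a * g + real b * g' - c" ..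
  have "h a b = real a * g + real b * g' - c"
    by (rule h_eqI[of "\<Gamma> t"]) (use t le in \<open>auto simp: path_image_def\<close>)
  then show "c = real a * g + real b * g' - h a b" by simp
qed

end

subsection \<open>Lengths and areas of the cut triangles\<close>

text \<open>The minimum of \<open>f + k g\<close> is at most \<open>f x\<close> because
  \<open>g x = 0\<close>. For large \<open>k\<close> the points with \<open>f\<close> at most
  \<open>f x - \<epsilon>\<close> cannot be minimisers, since \<open>g\<close> has a positive lower
  bound on that compact set.\<close>

lemma compact_min_add_multiple_tendsto:
  fixes f g :: "'a::topological_space \<Rightarrow> real"
  assumes S: "compact S" and f: "continuous_on S f" and g: "continuous_on S g"
    and x: "x \<in> S" "g x = 0" and pos: "\<And>y. y \<in> S \<Longrightarrow> y \<noteq> x \<Longrightarrow> 0 < g y"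
    and m_le: "\<And>k y. y \<in> S \<Longrightarrow> m k \<le> f y + real k * g y"
    and m_att: "\<And>k. \<exists>y\<in>S. m k = f y + real k * g y"
  shows "m \<longlonglongrightarrow> f x"
proof (rule LIMSEQ_I)
  fix \<epsilon> :: real assume eps: "\<epsilon> > 0"
  define Z where "Z = {y \<in> S. f y \<le> f x - \<epsilon>}"
  have "compact Z"
  proof -
    have "closedin (top_of_set S) (S \<inter> f -` {..f x - \<epsilon>})"
      by (rule continuous_closedin_preimage[OF f closed_atMost])
    moreover have "S \<inter> f -` {..f x - \<epsilon>} = Z" by (auto simp: Z_def)
    ultimately show ?thesis using S closedin_compact by metis
  qed
  have gnn: "0 \<le> g y" if "y \<in> S" for y using pos[OF that] x by (cases "y = x") auto
  obtain N where N: "\<And>y k. y \<in> Z \<Longrightarrow> N \<le> k \<Longrightarrow> f x - \<epsilon> < f y + real k * g y"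
  proof (cases "Z = {}")
    case True then show ?thesis using that by blast
  next
    case False
    have ZS: "Z \<subseteq> S" by (auto simp: Z_def)
    obtain y0 where y0: "y0 \<in> Z" "\<And>y. y \<in> Z \<Longrightarrow> g y0 \<le> g y"
      using continuous_attains_inf[OF \<open>compact Z\<close> False continuous_on_subset[OF g ZS]] by blast
    obtain y1 where y1: "y1 \<in> Z" "\<And>y. y \<in> Z \<Longrightarrow> f y1 \<le> f y"
      using continuous_attains_inf[OF \<open>compact Z\<close> False continuous_on_subset[OF f ZS]] by blast
    have "y0 \<noteq> x" using y0 eps by (auto simp: Z_def)
    then have g0: "0 < g y0" using pos y0 ZS by auto
    obtain N :: nat where N: "f x - f y1 < real N * g y0" using reals_Archimedean3[OF g0] by blast
    show ?thesis
    proof (rule that[of N])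
      fix y k assume "y \<in> Z" "N \<le> k"
      have "real N * g y0 \<le> real k * g y" using y0(2)[OF \<open>y \<in> Z\<close>] \<open>N \<le> k\<close> g0 by (intro mult_mono) auto
      then show "f x - \<epsilon> < f y + real k * g y" using N y1(2)[OF \<open>y \<in> Z\<close>] eps by linarith
    qed
  qed
  show "\<exists>N. \<forall>k\<ge>N. norm (m k - f x) < \<epsilon>"
  proof (intro exI allI impI)
    fix k assume "N \<le> k"
    have "m k \<le> f x" using m_le[OF x(1), of k] x by simp
    moreover obtain y where y: "y \<in> S" "m k = f y + real k * g y" using m_att by blast
    have "f x - \<epsilon> < m k"
    proof (cases "y \<in> Z")
      case True then show ?thesis using N \<open>N \<le> k\<close> y by simp
    next
      case False
      then have "f x - \<epsilon> < f y" using y by (simp add: Z_def)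
      moreover have "0 \<le> real k * g y" using gnn[OF y(1)] by simp
      ultimately show ?thesis using y by linarith
    qed
    ultimately show "norm (m k - f x) < \<epsilon>" using eps by (simp add: abs_if)
  qed
qed

context concave_curve_with_normals
begin

lemma h_tendsto:
  assumes ab: "a \<noteq> 0 \<or> b \<noteq> 0" and x: "x \<in> G" "lin (real a) (real b) x = h a b"
  shows "(\<lambda>k. h (c + k * a) (d + k * b) - real k * h a b) \<longlonglongrightarrow> lin (real c) (real d) x"
proof (rule compact_min_add_multiple_tendsto[OF compact_G, where g = "\<lambda>z. lin (real a) (real b) z - h a b"])
  have l: "lin (real (c + k * a)) (real (d + k * b)) y - real k * h a b
      = lin (real c) (real d) y + real k * (lin (real a) (real b) y - h a b)" for k y
    by (simp add: lin_def algebra_simps)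
  show "h (c + k * a) (d + k * b) - real k * h a b
      \<le> lin (real c) (real d) y + real k * (lin (real a) (real b) y - h a b)" if "y \<in> G" for k y
    using h_le[OF that, of "c + k * a" "d + k * b"] unfolding l[symmetric] by simp
  show "\<exists>y\<in>G. h (c + k * a) (d + k * b) - real k * h a b
      = lin (real c) (real d) y + real k * (lin (real a) (real b) y - h a b)" for k
    using h_min[of "c + k * a" "d + k * b"] unfolding l[symmetric] by auto
  show "0 < lin (real a) (real b) y - h a b" if "y \<in> G" "y \<noteq> x" for y
    using h_le[OF that(1), of a b] min_unique[OF ab that(1) _ x] that by fastforce
qed (use x in \<open>auto intro!: continuous_intros\<close>)

definition defect :: "nat \<times> nat \<times> nat \<times> nat \<Rightarrow> real" where
  "defect = (\<lambda>(a, b, c, d). h (a + c) (b + d) - h a b - h c d)"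

lemma defect_nonneg: "0 \<le> defect M"
  using h_superadd by (cases M) (simp add: defect_def algebra_simps)

text \<open>The cut-off side with normal \<open>(a + c, b + d)\<close> has length \<open>defect (a, b, c, d)\<close>, and all the
  later cuts adjacent to it exhaust it from both of its ends. This is the identity \<open>l + r = defect\<close>
  below; it makes the total sum satisfy \<open>2 F = p + q + F\<close>.\<close>

theorem has_sum_defect: "(defect has_sum (p + q)) SL2_nonneg"
proof -
  have "\<forall>m n. \<exists>x. x \<in> G \<and> lin (real m) (real n) x = h m n"
    using h_min by metis
  then obtain x where x: "\<And>m n. x m n \<in> G" "\<And>m n. lin (real m) (real n) (x m n) = h m n"
    by metis
  \<comment> \<open>The cuts along the tangent with normal \<open>(a, b)\<close> telescope, and the
    limit is the value at its touching point \<open>y\<close>.\<close>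
  have side: "(\<lambda>k. h (c + Suc k * a) (d + Suc k * b) - h (c + k * a) (d + k * b) - h a b) sums
      (lin (real c) (real d) y - h c d)"
    if "a \<noteq> 0 \<or> b \<noteq> 0" "y \<in> G" "lin (real a) (real b) y = h a b" for a b c d y
    using telescope_sums[OF h_tendsto[OF that, of c d]] by (simp add: algebra_simps)
  \<comment> \<open>The touching point of the tangent with normal \<open>u\<close> divides the
    cut-off side into pieces of lengths \<open>r\<close> and \<open>l\<close>, measured from the
    tangents of the first and the second row.\<close>
  define r where "r = (\<lambda>(a, b, c, d). lin (real a) (real b) (x (a + c) (b + d)) - h a b)"
  define l where "l = (\<lambda>(a, b, c, d). lin (real c) (real d) (x (a + c) (b + d)) - h c d)"
  show ?thesis
  proof (rule has_sum_of_branches[where r = r and l = l])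
    fix M assume "M \<in> SL2_nonneg"
    moreover obtain a b c d where M: "M = (a, b, c, d)" by (cases M) auto
    ultimately have pos: "a + c \<noteq> 0 \<or> b + d \<noteq> 0" using SL2_nonneg_pos by auto
    show "(\<lambda>k. defect (branch_right (M, k))) sums r M"
      using side[OF pos x, of a b] by (simp add: M r_def defect_def branch_right_def algebra_simps)
    show "(\<lambda>k. defect (antitranspose (branch_right (antitranspose M, k)))) sums l M"
      using side[OF pos x, of c d]
      by (simp add: M l_def defect_def branch_right_def antitranspose_def algebra_simps)
    show "l M + r M = defect M"
      using x(2)[of "a + c" "b + d"] by (simp add: M l_def r_def defect_def lin_def algebra_simps)
  next
    \<comment> \<open>The sides of the support triangle lie on the tangents with normals
      \<open>(0, 1)\<close> and \<open>(1, 0)\<close>, whose touching points are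
      \<open>\<Gamma> 1\<close> and \<open>\<Gamma> 0\<close>.\<close>
    show "(\<lambda>k. defect (1, k, 0, 1)) sums q"
      using side[of 0 1 "\<Gamma> 1" 1 0] G01 XY_vertices h_axes by (simp add: defect_def lin_def)
    show "(\<lambda>k. defect (1, 0, k, 1)) sums p"
      using side[of 1 0 "\<Gamma> 0" 0 1] G01 XY_vertices h_axes by (simp add: defect_def lin_def)
  qed (rule defect_nonneg)
qed

text \<open>The vector from \<open>C\<close> to \<open>\<Gamma> 0\<close> is \<open>p\<close> times
  the normal \<open>(\<alpha>, \<beta>)\<close> turned by a right angle; likewise for the other side
  with \<open>q\<close>.\<close>

lemma SL2_lengths: "SL2_length \<alpha> \<beta> (\<Gamma> 0) C = p" "SL2_length \<alpha>' \<beta>' (\<Gamma> 1) C = q"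
proof -
  have d: "\<Gamma> 0 = pt 0 p" "\<Gamma> 1 = pt q 0" "C = pt 0 0" by (rule eq_by_XY; simp add: XY_vertices)+
  have "pt 0 p - pt 0 0 = p *\<^sub>R vector [\<beta>, - \<alpha>]" "pt q 0 - pt 0 0 = q *\<^sub>R vector [- \<beta>', \<alpha>']"
    by (simp_all add: pt_def vec_eq_iff forall_2 algebra_simps)
  then have n: "dist (\<Gamma> 0) C = p * sqrt (\<alpha>\<^sup>2 + \<beta>\<^sup>2)" "dist (\<Gamma> 1) C = q * sqrt (\<alpha>'\<^sup>2 + \<beta>'\<^sup>2)"
    unfolding d dist_norm using pq_pos
    by (simp_all add: norm_eq_sqrt_inner[of "vector _"] inner_real2 power2_eq_square add.commute)
  have "\<alpha> \<noteq> 0 \<or> \<beta> \<noteq> 0" "\<alpha>' \<noteq> 0 \<or> \<beta>' \<noteq> 0" using det by auto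
  then have "sqrt (\<alpha>\<^sup>2 + \<beta>\<^sup>2) \<noteq> 0" "sqrt (\<alpha>'\<^sup>2 + \<beta>'\<^sup>2) \<noteq> 0" by (simp_all add: sum_power2_eq_zero_iff)
  then show "SL2_length \<alpha> \<beta> (\<Gamma> 0) C = p" "SL2_length \<alpha>' \<beta>' (\<Gamma> 1) C = q"
    using n by (simp_all add: SL2_length_def)
qed

lemma measure_triangle_XY:
  "measure lebesgue (convex hull {P, Q, R})
    = \<bar>(X R - X P) * (Y Q - Y P) - (X Q - X P) * (Y R - Y P)\<bar> / 2"
proof -
  have "(R $ 1 - P $ 1) * (Q $ 2 - P $ 2) - (Q $ 1 - P $ 1) * (R $ 2 - P $ 2)
      = ((R $ 1 - P $ 1) * (Q $ 2 - P $ 2) - (Q $ 1 - P $ 1) * (R $ 2 - P $ 2)) * (\<alpha> * \<beta>' - \<beta> * \<alpha>')"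
    using det by simp
  also have "\<dots> = (X R - X P) * (Y Q - Y P) - (X Q - X P) * (Y R - Y P)"
    unfolding X_def Y_def by algebra
  finally have "(R $ 1 - P $ 1) * (Q $ 2 - P $ 2) - (Q $ 1 - P $ 1) * (R $ 2 - P $ 2)
      = (X R - X P) * (Y Q - Y P) - (X Q - X P) * (Y R - Y P)" .
  moreover have "convex hull {P, Q, R} \<in> sets lborel"
    by (simp add: borel_compact compact_convex_hull)
  ultimately show ?thesis by (simp only: measure_completion content_triangle)
qed

lemma cut_triangle_lin:
  assumes "(a, b, c, d) \<in> SL2_nonneg"
  shows "cut_triangle \<Gamma> \<alpha> \<beta> \<alpha>' \<beta>' a b c d =
    {z. h a b \<le> lin (real a) (real b) z} \<inter> {z. h c d \<le> lin (real c) (real d) z} \<inter>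
    {z. lin (real (a + c)) (real (b + d)) z \<le> h (a + c) (b + d)}"
proof -
  have "a \<noteq> 0 \<or> b \<noteq> 0" "c \<noteq> 0 \<or> d \<noteq> 0" "a + c \<noteq> 0 \<or> b + d \<noteq> 0"
    using SL2_nonneg_pos[OF assms] by auto
  then show ?thesis
    unfolding cut_triangle_def half_plane_le_lin half_plane_ge_lin
    by (simp only: tangent_const_eq) simp
qed

text \<open>In the unimodular coordinates \<open>s\<close>, \<open>t\<close> given by the two rows
  the mediant is \<open>s + t\<close>. The triangle becomes \<open>h a b \<le> s\<close>,
  \<open>h c d \<le> t\<close>, \<open>s + t \<le> h (a + c) (b + d)\<close>, with legs of length
  \<open>D\<close>; \<open>V\<close> is the inverse coordinate map.\<close>

lemma cut_triangle_hull:
  assumes M: "(a, b, c, d) \<in> SL2_nonneg"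
  defines "V s t \<equiv> pt (real d * s - real b * t) (real a * t - real c * s)"
  defines "D \<equiv> defect (a, b, c, d)"
  shows "cut_triangle \<Gamma> \<alpha> \<beta> \<alpha>' \<beta>' a b c d =
    convex hull {V (h a b) (h c d), V (h a b + D) (h c d), V (h a b) (h c d + D)}" (is "?L = ?R")
proof
  have "int a * int d - int b * int c = 1" using M by (simp add: SL2_nonneg_def)
  then have "real_of_int (int a * int d - int b * int c) = 1" by simp
  then have dt: "real a * real d - real b * real c = 1" by simp
  have V: "lin (real a) (real b) (V s t) = s" "lin (real c) (real d) (V s t) = t" for s t
  proof -
    have "lin (real a) (real b) (V s t) = s * (real a * real d - real b * real c)"
      "lin (real c) (real d) (V s t) = t * (real a * real d - real b * real c)"
      by (simp_all add: V_def lin_def algebra_simps)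
    then show "lin (real a) (real b) (V s t) = s" "lin (real c) (real d) (V s t) = t" using dt by simp_all
  qed
  have inV: "z = V (lin (real a) (real b) z) (lin (real c) (real d) z)" for z
  proof (rule eq_by_XY)
    have "X z * (real a * real d - real b * real c) = X (V (lin (real a) (real b) z) (lin (real c) (real d) z))"
      "Y z * (real a * real d - real b * real c) = Y (V (lin (real a) (real b) z) (lin (real c) (real d) z))"
      by (simp_all add: V_def lin_def algebra_simps)
    then show "X z = X (V (lin (real a) (real b) z) (lin (real c) (real d) z))"
      "Y z = Y (V (lin (real a) (real b) z) (lin (real c) (real d) z))" using dt by simp_all
  qed
  have sum: "lin (real (a + c)) (real (b + d)) z = lin (real a) (real b) z + lin (real c) (real d) z" for z
    by (simp add: lin_def algebra_simps)
  have D: "D \<ge> 0" "h (a + c) (b + d) = D + h a b + h c d"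
    unfolding D_def using defect_nonneg by (auto simp: defect_def)
  show "?R \<subseteq> ?L"
    unfolding cut_triangle_lin[OF M]
  proof (rule hull_minimal)
    show "convex ({z. h a b \<le> lin (real a) (real b) z} \<inter> {z. h c d \<le> lin (real c) (real d) z} \<inter>
      {z. lin (real (a + c)) (real (b + d)) z \<le> h (a + c) (b + d)})"
      by (intro convex_Int convex_lin_ge convex_lin_le)
  qed (use D in \<open>auto simp: V sum simp del: of_nat_add\<close>)
  show "?L \<subseteq> ?R"
  proof
    fix z assume "z \<in> ?L"
    then have z: "h a b \<le> lin (real a) (real b) z" "h c d \<le> lin (real c) (real d) z"
      "lin (real a) (real b) z + lin (real c) (real d) z \<le> D + h a b + h c d"
      unfolding cut_triangle_lin[OF M] using sum D by auto
    define s where "s = lin (real a) (real b) z - h a b"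
    define t where "t = lin (real c) (real d) z - h c d"
    have st: "0 \<le> s" "0 \<le> t" "s + t \<le> D" using z by (auto simp: s_def t_def)
    have zV: "z = V (h a b + s) (h c d + t)" using inV[of z] by (simp add: s_def t_def)
    show "z \<in> ?R"
    \<comment> \<open>The barycentric coordinates divide by \<open>D\<close>, so the triangle
      degenerated to a point is treated separately.\<close>
    proof (cases "D = 0")
      case True
      then have "s = 0" "t = 0" using st by auto
      then show ?thesis unfolding zV by (simp add: hull_inc)
    next
      case False
      let ?u = "1 - s / D - t / D" and ?v = "s / D" and ?w = "t / D"
      have "z = ?u *\<^sub>R V (h a b) (h c d) + ?v *\<^sub>R V (h a b + D) (h c d) + ?w *\<^sub>R V (h a b) (h c d + D)"
      proof -
        have *: "V (s1 + D * v) (t1 + D * w)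
            = (1 - v - w) *\<^sub>R V s1 t1 + v *\<^sub>R V (s1 + D) t1 + w *\<^sub>R V s1 (t1 + D)" for s1 t1 v w
          by (simp add: V_def pt_def vec_eq_iff forall_2 algebra_simps)
        show ?thesis unfolding zV using *[of "h a b" ?v "h c d" ?w] False by simp
      qed
      moreover have "?u = (D - s - t) / D" using False by (simp add: diff_divide_distrib)
      then have "0 \<le> ?u" "0 \<le> ?v" "0 \<le> ?w" using st D by simp_all
      ultimately show ?thesis unfolding convex_hull_3
        by (intro CollectI exI[of _ ?u] exI[of _ ?v] exI[of _ ?w]) auto
    qed
  qed
qed

lemma cut_triangle_measure:
  assumes M: "(a, b, c, d) \<in> SL2_nonneg"
  shows "cut_triangle \<Gamma> \<alpha> \<beta> \<alpha>' \<beta>' a b c d \<in> lmeasurable"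
    and "measure lebesgue (cut_triangle \<Gamma> \<alpha> \<beta> \<alpha>' \<beta>' a b c d) = (defect (a, b, c, d))\<^sup>2 / 2"
proof -
  have "int a * int d - int b * int c = 1" using M by (simp add: SL2_nonneg_def)
  then have "real_of_int (int a * int d - int b * int c) = 1" by simp
  then have dt: "real a * real d - real b * real c = 1" by simp
  show "cut_triangle \<Gamma> \<alpha> \<beta> \<alpha>' \<beta>' a b c d \<in> lmeasurable"
    unfolding cut_triangle_hull[OF M] by (intro lmeasurable_compact compact_convex_hull) auto
  let ?D = "defect (a, b, c, d)"
  have "measure lebesgue (cut_triangle \<Gamma> \<alpha> \<beta> \<alpha>' \<beta>' a b c d)
      = \<bar>(- real b * ?D) * (- real c * ?D) - (real d * ?D) * (real a * ?D)\<bar> / 2"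
    unfolding cut_triangle_hull[OF M] measure_triangle_XY by (simp add: algebra_simps)
  also have "(- real b * ?D) * (- real c * ?D) - (real d * ?D) * (real a * ?D)
      = - (?D\<^sup>2 * (real a * real d - real b * real c))"
    by (simp add: algebra_simps power2_eq_square)
  finally show "measure lebesgue (cut_triangle \<Gamma> \<alpha> \<beta> \<alpha>' \<beta>' a b c d) = ?D\<^sup>2 / 2"
    unfolding dt by simp
qed

lemma f_Gamma_eq:
  assumes "(a, b, c, d) \<in> SL2_nonneg"
  shows "f_Gamma \<Gamma> \<alpha> \<beta> \<alpha>' \<beta>' a b c d = defect (a, b, c, d)"
  unfolding f_Gamma_def cut_triangle_measure(2)[OF assms] using defect_nonneg by simp

end

subsection \<open>The region between the curve and its support triangle\<close>

context concave_curve_with_normals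
begin

abbreviation "J \<equiv> closed_segment (\<Gamma> 0) C \<union> closed_segment (\<Gamma> 1) C \<union> G"

lemma closure_K_eq: "closure K = K \<union> frontier K"
  using K by (simp add: frontier_def interior_open closure_subset Un_absorb1)

lemma G_closure_K: "G \<subseteq> closure K"
  using frontier_K by (auto simp: frontier_def)

lemma K_XY_pos: "z \<in> K \<Longrightarrow> 0 < X z" "z \<in> K \<Longrightarrow> 0 < Y z"
  using K_greater[of z 1 0] K_greater[of z 0 1] by (auto simp: h_axes lin_def)

lemma K_below_chord:
  assumes "z \<in> K"
  shows "p * X z + q * Y z < p * q"
proof -
  have "- (p * q) < lin (-p) (-q) z"
    by (rule open_lin_less[OF K(1) _ _ assms]) (use K_subset_T T_iff pq_pos in \<open>auto simp: lin_def\<close>)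
  then show ?thesis by (simp add: lin_def)
qed

lemma J_subset_T: "J \<subseteq> T"
proof -
  have "closed_segment (\<Gamma> 0) C \<subseteq> T" "closed_segment (\<Gamma> 1) C \<subseteq> T"
    unfolding segment_convex_hull by (intro hull_mono; auto)+
  then show ?thesis using triangle by auto
qed

lemma XY_combination:
  "X ((1 - u) *\<^sub>R x + u *\<^sub>R y) = (1 - u) * X x + u * X y"
  "Y ((1 - u) *\<^sub>R x + u *\<^sub>R y) = (1 - u) * Y x + u * Y y"
  unfolding X_lin Y_lin by (rule lin_combination; simp)+

lemma sides_XY:
  "z \<in> closed_segment (\<Gamma> 0) C \<longleftrightarrow> X z = 0 \<and> 0 \<le> Y z \<and> Y z \<le> p"
  "z \<in> closed_segment (\<Gamma> 1) C \<longleftrightarrow> Y z = 0 \<and> 0 \<le> X z \<and> X z \<le> q"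
proof -
  note l = XY_combination
  show "z \<in> closed_segment (\<Gamma> 0) C \<longleftrightarrow> X z = 0 \<and> 0 \<le> Y z \<and> Y z \<le> p"
  proof
    assume "z \<in> closed_segment (\<Gamma> 0) C"
    then show "X z = 0 \<and> 0 \<le> Y z \<and> Y z \<le> p"
      using pq_pos by (auto simp: in_segment l XY_vertices mult_le_cancel_right1)
  next
    assume z: "X z = 0 \<and> 0 \<le> Y z \<and> Y z \<le> p"
    have "z = (1 - (1 - Y z / p)) *\<^sub>R \<Gamma> 0 + (1 - Y z / p) *\<^sub>R C"
      by (rule eq_by_XY; unfold l; use z pq_pos in \<open>simp add: XY_vertices\<close>)
    moreover have "0 \<le> 1 - Y z / p" "1 - Y z / p \<le> 1" using z pq_pos by auto
    ultimately show "z \<in> closed_segment (\<Gamma> 0) C" unfolding in_segment by blast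
  qed
  show "z \<in> closed_segment (\<Gamma> 1) C \<longleftrightarrow> Y z = 0 \<and> 0 \<le> X z \<and> X z \<le> q"
  proof
    assume "z \<in> closed_segment (\<Gamma> 1) C"
    then show "Y z = 0 \<and> 0 \<le> X z \<and> X z \<le> q"
      using pq_pos by (auto simp: in_segment l XY_vertices mult_le_cancel_right1)
  next
    assume z: "Y z = 0 \<and> 0 \<le> X z \<and> X z \<le> q"
    have "z = (1 - (1 - X z / q)) *\<^sub>R \<Gamma> 1 + (1 - X z / q) *\<^sub>R C"
      by (rule eq_by_XY; unfold l; use z pq_pos in \<open>simp add: XY_vertices\<close>)
    moreover have "0 \<le> 1 - X z / q" "1 - X z / q \<le> 1" using z pq_pos by auto
    ultimately show "z \<in> closed_segment (\<Gamma> 1) C" unfolding in_segment by blast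
  qed
qed

lemma chord_XY:
  assumes "z \<in> closed_segment (\<Gamma> 0) (\<Gamma> 1)"
  shows "0 \<le> X z" "0 \<le> Y z" "p * X z + q * Y z = p * q" "X z = 0 \<Longrightarrow> z = \<Gamma> 0" "Y z = 0 \<Longrightarrow> z = \<Gamma> 1"
proof -
  obtain u where u: "0 \<le> u" "u \<le> 1" "z = (1 - u) *\<^sub>R \<Gamma> 0 + u *\<^sub>R \<Gamma> 1"
    using assms by (auto simp: in_segment)
  have X: "X z = u * q"
    unfolding u(3) XY_combination by (simp add: XY_vertices)
  have Y: "Y z = (1 - u) * p"
    unfolding u(3) XY_combination by (simp add: XY_vertices)
  show "0 \<le> X z" unfolding X using u(1) pq_pos by simp
  show "0 \<le> Y z" unfolding Y using u(2) pq_pos by simp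
  show "p * X z + q * Y z = p * q" unfolding X Y by (simp add: algebra_simps)
  show "X z = 0 \<Longrightarrow> z = \<Gamma> 0" "Y z = 0 \<Longrightarrow> z = \<Gamma> 1" using X Y u(3) pq_pos by auto
qed

lemma outside_T: "z \<notin> T \<Longrightarrow> z \<in> outside J"
  using outside_mono[OF J_subset_T] outside_convex[of T] by auto

text \<open>Everything off \<open>T\<close> is exterior. A point of \<open>K\<close> is exterior
  too: from \<open>K\<close> one can leave \<open>T\<close> through a point of the chord that is not
  on the curve, without meeting \<open>J\<close>.\<close>

lemma inside_J_subset: "inside J \<subseteq> T - K"
proof
  fix z assume z: "z \<in> inside J"
  have zT: "z \<in> T" using outside_T[of z] z inside_Int_outside[of J] by blast
  have "z \<notin> K"
  proof
    assume "z \<in> K"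
    have "\<Gamma> 0 \<noteq> \<Gamma> 1" using XY_vertices pq_pos by auto
    then obtain c where c: "c \<in> closed_segment (\<Gamma> 0) (\<Gamma> 1)" "c \<notin> G" using no_segment by blast
    have "X c \<noteq> 0" "Y c \<noteq> 0" using chord_XY(4,5)[OF c(1)] c(2) G01 by auto
    then have cXY: "0 < X c" "0 < Y c" using chord_XY(1,2)[OF c(1)] by auto
    have cK: "c \<in> closure K" using c(1) frontier_K by (auto simp: frontier_def)
    \<comment> \<open>The point \<open>c\<close> moved away from \<open>C\<close> to twice its
      distance, hence beyond the chord.\<close>
    define e where "e = pt (2 * X c) (2 * Y c)"
    have seg: "X y = (1 + u) * X c" "Y y = (1 + u) * Y c" if "y = (1 - u) *\<^sub>R c + u *\<^sub>R e" for y u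
      unfolding that XY_combination by (simp_all add: e_def algebra_simps)
    define Q where "Q = (K \<union> {c}) \<union> closed_segment c e"
    have "connected (K \<union> {c})"
    proof (rule connected_intermediate_closure)
      show "connected K" using K(2) by (rule convex_connected)
      show "K \<union> {c} \<subseteq> closure K" using cK closure_subset by blast
    qed blast
    then have "connected Q" unfolding Q_def by (rule connected_Un) auto
    moreover have "z \<in> Q" using \<open>z \<in> K\<close> by (simp add: Q_def)
    then have "inside J \<inter> Q \<noteq> {}" using z by blast
    moreover have "e \<in> Q" by (simp add: Q_def)
    have "e \<in> outside J"
    proof (rule outside_T)
      have "p * X e + q * Y e = 2 * (p * X c + q * Y c)" by (simp add: e_def algebra_simps)
      then have "p * q < p * X e + q * Y e" using chord_XY(3)[OF c(1)] pq_pos by simp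
      then show "e \<notin> T" unfolding T_iff by simp
    qed
    then have "outside J \<inter> Q \<noteq> {}" using \<open>e \<in> Q\<close> by blast
    ultimately have "J \<inter> Q \<noteq> {}" by (rule inside_outside_intersect_connected)
    then obtain y where y: "y \<in> J" "y \<in> Q" by blast
    show False
    proof (cases "y \<in> K")
      case True
      then have "y \<notin> G" using frontier_K K by (auto simp: frontier_def interior_open)
      then show False using y(1) K_XY_pos[OF True] by (auto simp: sides_XY)
    next
      case False
      then have "y \<in> closed_segment c e" using y(2) by (auto simp: Q_def)
      then obtain u where u: "0 \<le> u" "u \<le> 1" "y = (1 - u) *\<^sub>R c + u *\<^sub>R e"
        unfolding in_segment by blast
      have yXY: "0 < X y" "0 < Y y" unfolding seg[OF u(3)] using u cXY by auto
      then have "y \<in> G" using y(1) by (auto simp: sides_XY)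
      moreover have "p * X y + q * Y y = (1 + u) * (p * q)"
        unfolding seg[OF u(3)] chord_XY(3)[OF c(1), symmetric] by (simp add: algebra_simps)
      moreover have "y \<in> T" using y J_subset_T by blast
      ultimately have "(1 + u) * (p * q) \<le> 1 * (p * q)" unfolding T_iff by simp
      moreover have "0 < p * q" using pq_pos by simp
      ultimately have "1 + u \<le> 1" by (simp only: mult_le_cancel_right_pos)
      then have "u = 0" using u(1) by simp
      then have "y = c" using u(3) by simp
      then show False using c(2) \<open>y \<in> G\<close> by simp
    qed
  qed
  with zT show "z \<in> T - K" by blast
qed

lemma continuous_on_XY [continuous_intros]: "continuous_on S X" "continuous_on S Y"
  using continuous_on_lin[of S 1 0] continuous_on_lin[of S 0 1] by (simp_all add: lin_def)

text \<open>Take barycentric coordinates for the triangle of a point \<open>k\<close> of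
  \<open>K\<close> and the two end points. The weights of the end points stay positive near an inner
  point of the chord, and the weight \<open>\<nu>\<close> of \<open>k\<close> is nonnegative on
  \<open>T\<close>. So near that point \<open>T\<close> lies in this triangle.\<close>

lemma chord_neighbourhood:
  assumes "y \<in> closed_segment (\<Gamma> 0) (\<Gamma> 1)" "0 < X y" "0 < Y y"
  obtains U where "open U" "y \<in> U" "U \<inter> T \<subseteq> closure K"
proof -
  obtain k where k: "k \<in> K" using K by blast
  define \<nu> where "\<nu> z = (p * q - (p * X z + q * Y z)) / (p * q - (p * X k + q * Y k))" for z
  define U where "U = {z. 0 < Y z - \<nu> z * Y k} \<inter> {z. 0 < X z - \<nu> z * X k}"
  have kpos: "0 < p * q - (p * X k + q * Y k)" using K_below_chord[OF k] by simp
  show ?thesis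
  proof
    show "open U" unfolding U_def \<nu>_def
      by (intro open_Int open_Collect_less continuous_intros) (use kpos in auto)
    show "y \<in> U" using assms chord_XY(3)[OF assms(1)] by (simp add: U_def \<nu>_def)
    show "U \<inter> T \<subseteq> closure K"
    proof
      fix z assume z: "z \<in> U \<inter> T"
      have nu: "0 \<le> \<nu> z" using z T_iff kpos by (auto simp: \<nu>_def)
      define l where "l = (Y z - \<nu> z * Y k) / p"
      define m where "m = (X z - \<nu> z * X k) / q"
      have lm: "0 \<le> l" "0 \<le> m" using z pq_pos by (auto simp: l_def m_def U_def)
      have e: "\<nu> z * (p * q - (p * X k + q * Y k)) = p * q - (p * X z + q * Y z)"
        using kpos by (simp add: \<nu>_def)
      have pl: "p * l = Y z - \<nu> z * Y k" and qm: "q * m = X z - \<nu> z * X k"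
        using pq_pos by (simp_all add: l_def m_def)
      have "p * q * (\<nu> z + l + m) = p * q * \<nu> z + q * (p * l) + p * (q * m)"
        by (simp add: algebra_simps)
      also have "\<dots> = p * q * \<nu> z + q * (Y z - \<nu> z * Y k) + p * (X z - \<nu> z * X k)"
        unfolding pl qm ..
      also have "\<dots> = p * q" using e by (simp add: algebra_simps)
      finally have s: "\<nu> z + l + m = 1" using pq_pos by simp
      have "z = \<nu> z *\<^sub>R k + l *\<^sub>R \<Gamma> 0 + m *\<^sub>R \<Gamma> 1"
      proof (rule eq_by_XY)
        have m': "m = 1 - \<nu> z - l" using s by simp
        have *: "lin a b (\<nu> z *\<^sub>R k + l *\<^sub>R \<Gamma> 0 + m *\<^sub>R \<Gamma> 1)
            = \<nu> z * lin a b k + l * lin a b (\<Gamma> 0) + m * lin a b (\<Gamma> 1)" for a b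
          unfolding m' by (simp add: lin_inner inner_add_right algebra_simps)
        show "X z = X (\<nu> z *\<^sub>R k + l *\<^sub>R \<Gamma> 0 + m *\<^sub>R \<Gamma> 1)"
          using *[of 1 0] pq_pos by (simp add: lin_def XY_vertices m_def)
        show "Y z = Y (\<nu> z *\<^sub>R k + l *\<^sub>R \<Gamma> 0 + m *\<^sub>R \<Gamma> 1)"
          using *[of 0 1] pq_pos by (simp add: lin_def XY_vertices l_def)
      qed
      then have "z \<in> convex hull {k, \<Gamma> 0, \<Gamma> 1}"
        unfolding convex_hull_3 using nu lm s by blast
      also have "\<dots> \<subseteq> closure K"
        using k closure_subset G_closure_K G01 K by (intro hull_minimal convex_closure) auto
      finally show "z \<in> closure K" .
    qed
  qed
qed

text \<open>The open triangle without \<open>closure K\<close> has its frontier in \<open>J\<close>: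
  frontier points inside the chord and off the curve are excluded by
  \<open>chord_neighbourhood\<close>. Hence the component of \<open>z\<close> in the complement of
  \<open>J\<close> cannot leave this bounded set.\<close>

lemma region_subset_inside_J:
  assumes z: "0 < X z" "0 < Y z" "p * X z + q * Y z < p * q" "z \<notin> closure K"
  shows "z \<in> inside J"
proof -
  define V where "V = {z. 0 < X z} \<inter> {z. 0 < Y z} \<inter> {z. p * X z + q * Y z < p * q} - closure K"
  have "open V" unfolding V_def
    by (intro open_Diff open_Int open_Collect_less continuous_intros) auto
  have "V \<subseteq> T"
  proof
    fix y assume "y \<in> V"
    then show "y \<in> T" unfolding T_iff by (simp add: V_def)
  qed
  have bT: "compact T" by (intro compact_convex_hull) auto
  have cV: "closure V \<subseteq> T" using \<open>V \<subseteq> T\<close> bT by (intro closure_minimal compact_imp_closed)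
  have zV: "z \<in> V" using z by (simp add: V_def)
  have fr: "frontier V \<subseteq> J"
  proof (rule ccontr)
    assume "\<not> frontier V \<subseteq> J"
    then obtain y where y: "y \<in> closure V" "y \<notin> V" "y \<notin> J"
      using \<open>open V\<close> by (auto simp: frontier_def interior_open)
    have yT: "0 \<le> X y" "0 \<le> Y y" "p * X y + q * Y y \<le> p * q" using y cV T_iff by auto
    have "X y \<noteq> 0"
    proof
      assume "X y = 0"
      then have "q * Y y \<le> q * p" using yT by (simp add: mult.commute)
      then have "Y y \<le> p" using pq_pos by simp
      then show False using y(3) yT \<open>X y = 0\<close> sides_XY by auto
    qed
    moreover have "Y y \<noteq> 0"
    proof
      assume "Y y = 0"
      then have "p * X y \<le> p * q" using yT by simp
      then have "X y \<le> q" using pq_pos by simp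
      then show False using y(3) yT \<open>Y y = 0\<close> sides_XY by auto
    qed
    ultimately have pos: "0 < X y" "0 < Y y" using yT by auto
    have "y \<notin> K"
    proof
      assume "y \<in> K"
      then have "K \<inter> V \<noteq> {}" using y(1) K(1) open_Int_closure_eq_empty[of K V] by auto
      then show False using closure_subset by (auto simp: V_def)
    qed
    have "y \<in> closed_segment (\<Gamma> 0) (\<Gamma> 1)"
    proof (cases "y \<in> closure K")
      case True
      then show ?thesis using \<open>y \<notin> K\<close> y(3) closure_K_eq frontier_K by auto
    next
      case False
      then have e: "p * X y + q * Y y = p * q" using y(2) pos yT by (auto simp: V_def)
      let ?u = "X y / q"
      have "y = (1 - ?u) *\<^sub>R \<Gamma> 0 + ?u *\<^sub>R \<Gamma> 1"
      proof (rule eq_by_XY)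
        show "X y = X ((1 - ?u) *\<^sub>R \<Gamma> 0 + ?u *\<^sub>R \<Gamma> 1)"
          unfolding XY_combination using pq_pos by (simp add: XY_vertices)
        have "Y y = (1 - ?u) * p" using e pq_pos by (simp add: field_simps)
        then show "Y y = Y ((1 - ?u) *\<^sub>R \<Gamma> 0 + ?u *\<^sub>R \<Gamma> 1)"
          unfolding XY_combination by (simp add: XY_vertices)
      qed
      moreover have "p * X y \<le> p * q" using e pq_pos pos mult_pos_pos[of q "Y y"] by linarith
      then have "0 \<le> ?u" "?u \<le> 1" using pos pq_pos by auto
      ultimately show ?thesis unfolding in_segment by blast
    qed
    then obtain U where U: "open U" "y \<in> U" "U \<inter> T \<subseteq> closure K" using chord_neighbourhood pos by blast
    then have "U \<inter> V \<noteq> {}" using y(1) open_Int_closure_eq_empty[of U V] by auto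
    then show False using U(3) \<open>V \<subseteq> T\<close> by (auto simp: V_def)
  qed
  have zJ: "z \<notin> J"
    using z G_closure_K sides_XY by auto
  let ?C = "connected_component_set (- J) z"
  have "?C \<subseteq> V"
  proof (rule ccontr)
    assume "\<not> ?C \<subseteq> V"
    then have "?C - V \<noteq> {}" by blast
    moreover have "z \<in> ?C" using zJ by (simp add: connected_component_refl)
    then have "?C \<inter> V \<noteq> {}" using zV by blast
    ultimately have "?C \<inter> frontier V \<noteq> {}"
      by (intro connected_Int_frontier connected_connected_component)
    then show False using fr connected_component_subset[of "- J" z] by blast
  qed
  then have "?C \<subseteq> T" using \<open>V \<subseteq> T\<close> by (rule subset_trans)
  then have "bounded ?C" by (rule bounded_subset[OF compact_imp_bounded[OF bT]])
  then show ?thesis using zJ by (simp add: inside_def)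
qed

section \<open>Covering of generic points by cut triangles\<close>

lemma superadditive_excess: "superadditive (\<lambda>a b. h a b - lin (real a) (real b) z)"
proof
  show "h a b - lin (real a) (real b) z + (h c d - lin (real c) (real d) z)
      \<le> h (a + c) (b + d) - lin (real (a + c)) (real (b + d)) z" for a b c d
    using h_superadd[of a b c d] by (simp add: lin_def algebra_simps)
  show "h (k * a) (k * b) - lin (real (k * a)) (real (k * b)) z
      = real k * (h a b - lin (real a) (real b) z)" for k a b
    unfolding h_homogeneous by (simp add: lin_def algebra_simps)
qed

text \<open>A line separating \<open>z\<close> from \<open>closure K\<close> has positive
  coefficients in the coordinates \<open>X\<close>, \<open>Y\<close>. Scaled by a large integer,
  they are rounded up to naturals: on the curve this cannot lower the value, and at \<open>z\<close>
  it adds at most \<open>X z + Y z\<close>, which the scaled gap absorbs.\<close>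

lemma separating_normal:
  assumes z: "0 < X z" "0 < Y z" "p * X z + q * Y z < p * q" "z \<notin> closure K"
  obtains a b :: nat where "lin (real a) (real b) z < h a b"
proof -
  obtain w c0 where w: "w \<bullet> z < c0" "\<And>x. x \<in> closure K \<Longrightarrow> c0 < w \<bullet> x"
    using separating_hyperplane_closed_point[OF _ _ z(4)] K by (metis closed_closure convex_closure)
  define u where "u = w$2 * \<alpha>' - w$1 * \<beta>'"
  define v where "v = w$1 * \<beta> - w$2 * \<alpha>"
  define c where "c = c0 - w \<bullet> pt 0 0"
  have wl: "w \<bullet> x = w \<bullet> pt 0 0 + lin u v x" for x
  proof -
    have "w \<bullet> pt (X x) (Y x) = w \<bullet> pt 0 0 + lin u v x"
      by (simp add: pt_def inner_real2 lin_def u_def v_def algebra_simps)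
    then show ?thesis by (simp add: pt_XY)
  qed
  have sep: "lin u v z < c" "\<And>x. x \<in> closure K \<Longrightarrow> c < lin u v x"
  proof -
    show "lin u v z < c" using w(1) wl[of z] by (simp add: c_def)
    show "c < lin u v x" if "x \<in> closure K" for x using w(2)[OF that] wl[of x] by (simp add: c_def)
  qed
  have A: "lin u v z < v * p" and B: "lin u v z < u * q"
    using sep(2)[of "\<Gamma> 0"] sep(2)[of "\<Gamma> 1"] sep(1) G01 G_closure_K by (auto simp: lin_def XY_vertices)
  have Xq: "X z < q" and Yp: "Y z < p"
  proof -
    have "0 < q * Y z" "0 < p * X z" using z pq_pos by simp_all
    then have "p * X z < p * q" "q * Y z < p * q" using z(3) by linarith+
    then have "p * X z < p * q" "q * Y z < q * p" by (simp_all only: mult.commute)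
    then show "X z < q" "Y z < p" using pq_pos by simp_all
  qed
  \<comment> \<open>\<open>A\<close> and \<open>B\<close> compare \<open>z\<close> with the end
    points. If neither coefficient is positive, weighting them by \<open>q * Y z\<close> and
    \<open>p * X z\<close> contradicts the position of \<open>z\<close> below the chord; for mixed
    signs one of them suffices.\<close>
  have uv: "0 < u" "0 < v"
  proof -
    have False if "u \<le> 0" "v \<le> 0"
    proof -
      let ?m = "lin u v z"
      have "?m \<le> 0" using that z by (simp add: lin_def mult_nonpos_nonneg add_nonpos_nonpos)
      have "(p * X z) * ?m < (p * X z) * (u * q)" using B z pq_pos by simp
      moreover have "(q * Y z) * ?m < (q * Y z) * (v * p)" using A z pq_pos by simp
      ultimately have "(p * X z + q * Y z) * ?m < p * q * ?m"
        by (simp add: lin_def algebra_simps)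
      moreover have "p * q * ?m \<le> (p * X z + q * Y z) * ?m"
        using z(3) \<open>?m \<le> 0\<close> by (intro mult_right_mono_neg) auto
      ultimately show False by simp
    qed
    moreover have False if "u \<le> 0" "0 < v"
    proof -
      have "v * Y z < u * (q - X z)" using B by (simp add: lin_def algebra_simps)
      moreover have "u * (q - X z) \<le> 0" using that Xq by (simp add: mult_nonpos_nonneg)
      moreover have "0 < v * Y z" using that z by simp
      ultimately show False by simp
    qed
    moreover have False if "v \<le> 0" "0 < u"
    proof -
      have "u * X z < v * (p - Y z)" using A by (simp add: lin_def algebra_simps)
      moreover have "v * (p - Y z) \<le> 0" using that Yp by (simp add: mult_nonpos_nonneg)
      moreover have "0 < u * X z" using that z by simp
      ultimately show False by simp
    qed
    ultimately show "0 < u" "0 < v" by (meson not_less)+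
  qed
  obtain N :: nat where N: "X z + Y z < real N * (c - lin u v z)"
    using reals_Archimedean3[of "c - lin u v z"] sep(1) by auto
  define a where "a = nat \<lceil>real N * u\<rceil>"
  define b where "b = nat \<lceil>real N * v\<rceil>"
  have ab: "real N * u \<le> real a" "real a \<le> real N * u + 1" "real N * v \<le> real b" "real b \<le> real N * v + 1"
  proof -
    have "0 \<le> real N * u" "0 \<le> real N * v" using uv by simp_all
    then show "real N * u \<le> real a" "real a \<le> real N * u + 1" "real N * v \<le> real b" "real b \<le> real N * v + 1"
      unfolding a_def b_def by linarith+
  qed
  have "lin (real a) (real b) z \<le> (real N * u + 1) * X z + (real N * v + 1) * Y z"
    unfolding lin_def using ab z by (intro add_mono mult_right_mono) auto
  also have "\<dots> = real N * lin u v z + (X z + Y z)" by (simp add: lin_def algebra_simps)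
  also have "\<dots> < real N * c" using N by (simp add: algebra_simps)
  also have "\<dots> \<le> h a b"
  proof -
    obtain x where x: "x \<in> G" "h a b = lin (real a) (real b) x" using h_min by blast
    have "real N * c \<le> real N * lin u v x"
      using sep(2)[of x] x G_closure_K by (intro mult_left_mono) auto
    also have "\<dots> = (real N * u) * X x + (real N * v) * Y x" by (simp add: lin_def algebra_simps)
    also have "\<dots> \<le> h a b"
      unfolding x(2) lin_def using ab G_nonneg[OF x(1)] by (intro add_mono mult_right_mono) auto
    finally show ?thesis .
  qed
  finally show ?thesis by (rule that)
qed

text \<open>A null set off which all comparisons below are strict. The pair \<open>(0, 0)\<close> is
  left out because its equation holds in the whole plane.\<close>

definition exceptional :: "(real^2) set" where
  "exceptional = (\<Union>(a, b) \<in> - {(0, 0)}. {z. lin (real a) (real b) z = h a b})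
     \<union> {z. lin p q z = p * q} \<union> frontier K"

lemma negligible_exceptional: "negligible exceptional"
proof -
  have "negligible (\<Union>((\<lambda>(a, b). {z. lin (real a) (real b) z = h a b}) ` (- {(0, 0)})))"
    by (rule negligible_countable_Union) (auto intro!: negligible_lin_eq)
  moreover have "negligible {z. lin p q z = p * q}" using pq_pos by (intro negligible_lin_eq) auto
  ultimately show ?thesis
    unfolding exceptional_def using K negligible_convex_frontier by (intro negligible_Un) auto
qed

lemma not_exceptional:
  assumes "z \<notin> exceptional" "a \<noteq> 0 \<or> b \<noteq> 0"
  shows "lin (real a) (real b) z \<noteq> h a b"
proof
  assume "lin (real a) (real b) z = h a b"
  then have "z \<in> (case (a, b) of (a, b) \<Rightarrow> {z. lin (real a) (real b) z = h a b})" by simp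
  moreover have "(a, b) \<in> - {(0, 0)}" using assms(2) by auto
  ultimately show False using assms(1) unfolding exceptional_def by blast
qed

text \<open>The closed condition at the mediant and the strict one in \<open>crossing\<close> differ
  only on a tangent, which is exceptional.\<close>

lemma cut_triangle_crossing:
  assumes M: "(a, b, c, d) \<in> SL2_nonneg" and z: "z \<notin> exceptional"
  shows "z \<in> cut_triangle \<Gamma> \<alpha> \<beta> \<alpha>' \<beta>' a b c d \<longleftrightarrow>
    superadditive.crossing (\<lambda>a b. h a b - lin (real a) (real b) z) (a, b, c, d)"
proof -
  have "lin (real (a + c)) (real (b + d)) z \<noteq> h (a + c) (b + d)"
    using SL2_nonneg_pos[OF M] by (intro not_exceptional[OF z]) auto
  then show ?thesis
    unfolding cut_triangle_lin[OF M] superadditive.crossing_def[OF superadditive_excess] by auto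
qed

text \<open>For a point inside, the descent towards the vector from \<open>separating_normal\<close>
  starts at the identity matrix, whose rows have the values \<open>- X z\<close> and
  \<open>- Y z\<close>. Conversely, minimality of the mediant forces positive coordinates, and the
  tangent of the mediant separates \<open>z\<close> from \<open>K\<close>.\<close>

lemma generic_cut_iff:
  assumes z: "z \<notin> exceptional"
  shows "z \<in> inside J \<longleftrightarrow> (\<exists>(a, b, c, d) \<in> SL2_nonneg. z \<in> cut_triangle \<Gamma> \<alpha> \<beta> \<alpha>' \<beta>' a b c d)"
proof -
  interpret superadditive "\<lambda>a b. h a b - lin (real a) (real b) z" by (rule superadditive_excess)
  note ne = not_exceptional[OF z]
  have XY0: "X z \<noteq> 0" "Y z \<noteq> 0" using ne[of 1 0] ne[of 0 1] h_axes by (auto simp: lin_def)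
  have chord: "p * X z + q * Y z \<noteq> p * q" using z by (auto simp: exceptional_def lin_def)
  have fr: "z \<notin> frontier K" using z by (auto simp: exceptional_def)
  show ?thesis
  proof
    assume "z \<in> inside J"
    then have "z \<in> T" "z \<notin> K" using inside_J_subset by auto
    then have zT: "0 < X z" "0 < Y z" "p * X z + q * Y z < p * q" "z \<notin> closure K"
      using T_iff XY0 chord fr closure_K_eq by (auto simp: less_le)
    obtain a b where "lin (real a) (real b) z < h a b" using separating_normal[OF zT] .
    then have "\<exists>M \<in> SL2_nonneg. crossing M"
      using zT by (intro crossing_exists[of 1 0 0 1 a b]) (auto simp: SL2_nonneg_iff h_axes lin_def)
    then show "\<exists>(a, b, c, d) \<in> SL2_nonneg. z \<in> cut_triangle \<Gamma> \<alpha> \<beta> \<alpha>' \<beta>' a b c d"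
      using cut_triangle_crossing[OF _ z] by fast
  next
    assume "\<exists>(a, b, c, d) \<in> SL2_nonneg. z \<in> cut_triangle \<Gamma> \<alpha> \<beta> \<alpha>' \<beta>' a b c d"
    then obtain a b c d where M: "(a, b, c, d) \<in> SL2_nonneg"
      and cut: "z \<in> cut_triangle \<Gamma> \<alpha> \<beta> \<alpha>' \<beta>' a b c d" by blast
    have cr: "crossing (a, b, c, d)" using cut_triangle_crossing[OF M z] cut by blast
    note le = crossing_mediant_le[OF M cr]
    have ad: "0 < a" "0 < d" using SL2_nonneg_pos[OF M] .
    \<comment> \<open>A negative \<open>X z\<close> would make the value at \<open>(1, 0)\<close>
      positive, and then \<open>b + d\<close> could not exceed zero.\<close>
    have X: "0 < X z"
      using le(2)[of 1 0] ad XY0 by (fastforce simp: h_axes lin_def)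
    have Y: "0 < Y z"
      using le(1)[of 0 1] ad XY0 by (fastforce simp: h_axes lin_def)
    define m where "m = real (a + c)"
    define n where "n = real (b + d)"
    have m: "0 < m" "0 < n" using ad by (auto simp: m_def n_def)
    have less: "lin m n z < h (a + c) (b + d)"
      using cr by (simp add: crossing_def m_def n_def)
    have "h (a + c) (b + d) \<le> n * p" "h (a + c) (b + d) \<le> m * q"
      using h_le[OF G01(1), of "a + c" "b + d"] h_le[OF G01(2), of "a + c" "b + d"]
      by (auto simp: lin_def XY_vertices m_def n_def)
    then have mn: "lin m n z < n * p" "lin m n z < m * q" using less by auto
    have pos: "0 < lin m n z" using X Y m by (simp add: lin_def add_pos_pos)
    have "(p * X z) * lin m n z < (p * X z) * (m * q)" using mn X pq_pos by simp
    moreover have "(q * Y z) * lin m n z < (q * Y z) * (n * p)" using mn Y pq_pos by simp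
    ultimately have "(p * X z + q * Y z) * lin m n z < p * q * lin m n z"
      by (simp add: lin_def algebra_simps)
    then have "p * X z + q * Y z < p * q" using pos by simp
    moreover have "z \<notin> K"
      using K_greater[of z "a + c" "b + d"] less ad by (auto simp: m_def n_def)
    then have "z \<notin> closure K" using fr closure_K_eq by auto
    ultimately show "z \<in> inside J" using X Y by (intro region_subset_inside_J)
  qed
qed

text \<open>Off \<open>exceptional\<close> the cut triangles are disjoint and fill the inside of
  \<open>J\<close>, so countable additivity adds up their areas, half the squared defects.\<close>

theorem has_sum_defect_square: "((\<lambda>M. (defect M)\<^sup>2) has_sum (2 * measure lebesgue (inside J))) SL2_nonneg"
proof -
  define cut where "cut = (\<lambda>(a, b, c, d). cut_triangle \<Gamma> \<alpha> \<beta> \<alpha>' \<beta>' a b c d - exceptional)"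
  \<comment> \<open>Countable additivity is applied to a sequence, so matrices are encoded by
    \<open>to_nat\<close>; all other indices receive the empty set.\<close>
  define S where "S n = (if n \<in> to_nat ` SL2_nonneg then cut (from_nat n) else {})" for n :: nat
  have ex: "exceptional \<in> lmeasurable" "measure lebesgue exceptional = 0"
    using negligible_exceptional by (simp_all add: negligible_iff_measure)
  have cut: "cut M \<in> lmeasurable" "measure lebesgue (cut M) = (defect M)\<^sup>2 / 2" if "M \<in> SL2_nonneg" for M
  proof -
    obtain a b c d where M: "M = (a, b, c, d)" by (cases M) auto
    let ?T = "cut_triangle \<Gamma> \<alpha> \<beta> \<alpha>' \<beta>' a b c d"
    have T: "?T \<in> lmeasurable" "measure lebesgue ?T = (defect M)\<^sup>2 / 2"
      using cut_triangle_measure that M by auto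
    have "negligible (?T - cut M \<union> (cut M - ?T))"
      by (rule negligible_subset[OF negligible_exceptional]) (auto simp: cut_def M)
    then show "cut M \<in> lmeasurable" "measure lebesgue (cut M) = (defect M)\<^sup>2 / 2"
      using lmeasurable_negligible_symdiff[OF T(1)] measure_negligible_symdiff[OF T(1)] T(2) by auto
  qed
  have disj: "cut M \<inter> cut M' = {}" if "M \<in> SL2_nonneg" "M' \<in> SL2_nonneg" "M \<noteq> M'" for M M'
  proof -
    obtain a b c d where M: "M = (a, b, c, d)" by (cases M) auto
    obtain a' b' c' d' where M': "M' = (a', b', c', d')" by (cases M') auto
    have False if z: "z \<in> cut M" "z \<in> cut M'" for z
    proof -
      have "z \<notin> exceptional" using z by (simp add: cut_def M)
      then have "superadditive.crossing (\<lambda>a b. h a b - lin (real a) (real b) z) M"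
        "superadditive.crossing (\<lambda>a b. h a b - lin (real a) (real b) z) M'"
        using cut_triangle_crossing z \<open>M \<in> SL2_nonneg\<close> \<open>M' \<in> SL2_nonneg\<close> by (auto simp: cut_def M M')
      then show False
        using superadditive.crossing_unique[OF superadditive_excess] that \<open>M \<noteq> M'\<close>
          \<open>M \<in> SL2_nonneg\<close> \<open>M' \<in> SL2_nonneg\<close> unfolding M M' by blast
    qed
    then show ?thesis by blast
  qed
  have US: "(\<Union>n. S n) = (\<Union>M\<in>SL2_nonneg. cut M)"
    by (auto simp: S_def split: if_splits)
  have gen: "(\<Union>n. S n) = inside J - exceptional"
    unfolding US using generic_cut_iff by (fastforce simp: cut_def)
  have "bounded (\<Union>n. S n)"
  proof (rule bounded_subset)
    show "bounded T" by (intro compact_imp_bounded compact_convex_hull) auto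
    show "(\<Union>n. S n) \<subseteq> T" using gen inside_J_subset by blast
  qed
  moreover have "S n \<in> lmeasurable" for n using cut by (auto simp: S_def)
  moreover have "pairwise (\<lambda>m n. negligible (S m \<inter> S n)) UNIV"
    unfolding pairwise_def using disj by (auto simp: S_def)
  ultimately have sums: "(\<lambda>n. measure lebesgue (S n)) sums measure lebesgue (\<Union>n. S n)"
    and meas: "(\<Union>n. S n) \<in> lmeasurable"
    using measure_countable_negligible_Union_bounded[of S] measurable_countable_negligible_Union_bounded[of S]
    by blast+
  have "measure lebesgue (inside J) = measure lebesgue (\<Union>n. S n)"
    by (rule measure_negligible_symdiff[OF meas])
       (rule negligible_subset[OF negligible_exceptional], auto simp: gen)
  with sums have "((\<lambda>n. measure lebesgue (S n)) has_sum measure lebesgue (inside J)) UNIV"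
    by (intro sums_nonneg_imp_has_sum) auto
  then have "((\<lambda>n. measure lebesgue (S n)) has_sum measure lebesgue (inside J)) (to_nat ` SL2_nonneg)"
    by (subst has_sum_cong_neutral[where T = UNIV and g = "\<lambda>n. measure lebesgue (S n)"]) (auto simp: S_def)
  then have "((\<lambda>M. measure lebesgue (S (to_nat M))) has_sum measure lebesgue (inside J)) SL2_nonneg"
    by (subst (asm) has_sum_reindex) (auto simp: o_def)
  then have "((\<lambda>M. 2 * measure lebesgue (S (to_nat M))) has_sum (2 * measure lebesgue (inside J))) SL2_nonneg"
    by (rule has_sum_cmult_right)
  then show ?thesis
    by (subst has_sum_cong[where g = "\<lambda>M. 2 * measure lebesgue (S (to_nat M))"]) (auto simp: S_def cut)
qed

end

section \<open>Transfer to the geometric statement\<close>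

theorem theorem3:
  fixes \<Gamma> :: "real \<Rightarrow> real^2" and A B C :: "real^2" and T\<^sub>A T\<^sub>B :: "(real^2) set"
    and \<alpha> \<beta> \<alpha>' \<beta>' :: real and \<gamma> :: "nat \<Rightarrow> nat \<Rightarrow> real"
  assumes "strictly_concave_curve \<Gamma>"
    and "A = \<Gamma> 0" and "B = \<Gamma> 1"
    and "tangent_line_at \<Gamma> 0 T\<^sub>A" and "tangent_line_at \<Gamma> 1 T\<^sub>B"
    and "T\<^sub>A \<inter> T\<^sub>B = {C}"
    and "path_image \<Gamma> \<subseteq> convex hull {A, B, C}"
    and "choice_of_normals \<Gamma> \<alpha> \<beta> \<alpha>' \<beta>'"
    and "\<gamma> = tangent_const \<Gamma> \<alpha> \<beta> \<alpha>' \<beta>'"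
  shows "(\<lambda>(a, b, c, d). f_Gamma \<Gamma> \<alpha> \<beta> \<alpha>' \<beta>' a b c d powr 1) summable_on SL2_nonneg \<and>
         ((\<lambda>(a, b, c, d). \<bar>\<gamma> a b + \<gamma> c d - \<gamma> (a + c) (b + d)\<bar>)
            has_sum F_Gamma \<Gamma> \<alpha> \<beta> \<alpha>' \<beta>' 1) SL2_nonneg \<and>
         F_Gamma \<Gamma> \<alpha> \<beta> \<alpha>' \<beta>' 1 = SL2_length \<alpha> \<beta> A C + SL2_length \<alpha>' \<beta>' B C \<and>
         (\<lambda>(a, b, c, d). f_Gamma \<Gamma> \<alpha> \<beta> \<alpha>' \<beta>' a b c d powr 2) summable_on SL2_nonneg \<and>
         ((\<lambda>(a, b, c, d). (\<gamma> a b + \<gamma> c d - \<gamma> (a + c) (b + d))\<^sup>2)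
            has_sum F_Gamma \<Gamma> \<alpha> \<beta> \<alpha>' \<beta>' 2) SL2_nonneg \<and>
         F_Gamma \<Gamma> \<alpha> \<beta> \<alpha>' \<beta>' 2 = 2 * measure lebesgue (Gamma_triangle \<Gamma> C)"
proof -
  have arc: "arc \<Gamma>" and tangents: "\<And>t. t \<in> {0..1} \<Longrightarrow> \<exists>L. tangent_line_at \<Gamma> t L"
    and no_segment: "\<And>x y. x \<noteq> y \<Longrightarrow> \<not> closed_segment x y \<subseteq> path_image \<Gamma>"
    using assms(1) unfolding strictly_concave_curve_def by blast+
  obtain K where K: "open K" "convex K" "bounded K" "K \<noteq> {}"
    "frontier K = path_image \<Gamma> \<union> closed_segment (\<Gamma> 0) (\<Gamma> 1)"
    using assms(1) unfolding strictly_concave_curve_def by blast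
  obtain g g' where det: "\<alpha> * \<beta>' - \<beta> * \<alpha>' = 1"
    and g: "tangent_line_at \<Gamma> 0 (eq_line \<alpha> \<beta> g)" "tangent_line_at \<Gamma> 1 (eq_line \<alpha>' \<beta>' g')"
    and half: "path_image \<Gamma> \<subseteq> half_plane_le \<alpha> \<beta> g \<inter> half_plane_le \<alpha>' \<beta>' g'"
    using assms(8) unfolding choice_of_normals_def by blast
  have inj: "inj_on \<Gamma> {0..1}" using arc by (simp add: arc_def)
  \<comment> \<open>Tangents are unique, so the given end tangents are the lines of the chosen
    normals and \<open>C\<close> is their common point.\<close>
  have "T\<^sub>A = eq_line \<alpha> \<beta> g" "T\<^sub>B = eq_line \<alpha>' \<beta>' g'"
    using tangent_line_unique[OF assms(4) g(1) inj] tangent_line_unique[OF assms(5) g(2) inj] by simp_all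
  then have C: "C \<in> eq_line \<alpha> \<beta> g" "C \<in> eq_line \<alpha>' \<beta>' g'" using assms(6) by blast+
  interpret concave_curve_with_normals \<Gamma> K C \<alpha> \<beta> \<alpha>' \<beta>' g g'
    using arc tangents no_segment K det g half C assms(7) unfolding assms(2,3)
    by unfold_locales
  let ?f1 = "\<lambda>(a, b, c, d). f_Gamma \<Gamma> \<alpha> \<beta> \<alpha>' \<beta>' a b c d powr 1"
  let ?f2 = "\<lambda>(a, b, c, d). f_Gamma \<Gamma> \<alpha> \<beta> \<alpha>' \<beta>' a b c d powr 2"
  let ?g1 = "\<lambda>(a, b, c, d). \<bar>\<gamma> a b + \<gamma> c d - \<gamma> (a + c) (b + d)\<bar>"
  let ?g2 = "\<lambda>(a, b, c, d). (\<gamma> a b + \<gamma> c d - \<gamma> (a + c) (b + d))\<^sup>2"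
  have \<gamma>: "\<gamma> a b + \<gamma> c d - \<gamma> (a + c) (b + d) = defect (a, b, c, d)" if "(a, b, c, d) \<in> SL2_nonneg" for a b c d
  proof -
    have "a \<noteq> 0 \<or> b \<noteq> 0" "c \<noteq> 0 \<or> d \<noteq> 0" "a + c \<noteq> 0 \<or> b + d \<noteq> 0"
      using SL2_nonneg_pos[OF that] by auto
    then show ?thesis
      unfolding assms(9) by (simp only: tangent_const_eq) (simp add: defect_def algebra_simps)
  qed
  have eq1: "?f1 M = defect M" "?g1 M = defect M" if "M \<in> SL2_nonneg" for M
    using that \<gamma> f_Gamma_eq defect_nonneg[of M] by (auto split: prod.splits)
  have eq2: "?f2 M = (defect M)\<^sup>2" "?g2 M = (defect M)\<^sup>2" if "M \<in> SL2_nonneg" for M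
    using that \<gamma> f_Gamma_eq defect_nonneg[of M] by (auto split: prod.splits)
  have f1: "(?f1 has_sum (p + q)) SL2_nonneg" and g1: "(?g1 has_sum (p + q)) SL2_nonneg"
  proof -
    have "(?f1 has_sum (p + q)) SL2_nonneg \<longleftrightarrow> (defect has_sum (p + q)) SL2_nonneg"
      "(?g1 has_sum (p + q)) SL2_nonneg \<longleftrightarrow> (defect has_sum (p + q)) SL2_nonneg"
      by (rule has_sum_cong, erule eq1)+
    then show "(?f1 has_sum (p + q)) SL2_nonneg" "(?g1 has_sum (p + q)) SL2_nonneg"
      using has_sum_defect by blast+
  qed
  let ?m = "2 * measure lebesgue (Gamma_triangle \<Gamma> C)"
  have f2: "(?f2 has_sum ?m) SL2_nonneg" and g2: "(?g2 has_sum ?m) SL2_nonneg"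
  proof -
    have "(?f2 has_sum ?m) SL2_nonneg \<longleftrightarrow> ((\<lambda>M. (defect M)\<^sup>2) has_sum ?m) SL2_nonneg"
      "(?g2 has_sum ?m) SL2_nonneg \<longleftrightarrow> ((\<lambda>M. (defect M)\<^sup>2) has_sum ?m) SL2_nonneg"
      by (rule has_sum_cong, erule eq2)+
    then show "(?f2 has_sum ?m) SL2_nonneg" "(?g2 has_sum ?m) SL2_nonneg"
      using has_sum_defect_square unfolding Gamma_triangle_def by blast+
  qed
  have F: "F_Gamma \<Gamma> \<alpha> \<beta> \<alpha>' \<beta>' 1 = p + q" "F_Gamma \<Gamma> \<alpha> \<beta> \<alpha>' \<beta>' 2 = ?m"
    unfolding F_Gamma_def using infsumI[OF f1] infsumI[OF f2] by simp_all
  show ?thesis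
    unfolding F assms(2,3) SL2_lengths
    using has_sum_imp_summable[OF f1] has_sum_imp_summable[OF f2] g1 g2 by blast
qed

end
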